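(* For $n=1,2,\ldots$, the topological structure \[ \underset{\sim}{\mathbf{Z}}_{2n+1} = (\mathbf{Z}_{2n+1}; f_0,f_1,f_2,\ldots,f_n, g, \mathbf{0},\mathcal{T}) \] is an alter ego for $\mathbf{Z}_{2n+1}$ which yields a strong duality on $\mathsf{SA}_{2n+1}=\mathbb{ISP}(\mathbf{Z}_{2n+1})$.
   Context: Let $\mathbf{Z}=(\mathbb{Z};\wedge,\vee,\to,\neg)$ be the integers with the lattice operations of the natural order, $\neg a=-a$, and $a\to b=(-a)\vee b$ if $a\le b$, $a\to b=(-a)\wedge b$ otherwise (Sugihara algebra). For $n\ge 0$, $\mathbf{Z}_{2n+1}$ is the subalgebra with universe $\{a\in\mathbb{Z}\mid -n\le a\le n\}$, and $\mathsf{SA}_{2n+1}=\mathbb{ISP}(\mathbf{Z}_{2n+1})$ is the quasivariety it generates. The operations in the alter ego are: the partial endomorphism $f_0$ with domain $\mathbf{Z}_{2n+1}\setminus\{0\}$, $f_0(a)=a$; the partial endomorphism $f_1$ with domain $\mathbf{Z}_{2n+1}\setminus\{1,-1\}$, $f_1(a)=a$; for $1<i\le n$, the partial endomorphism $f_i$ with domain $\mathbf{Z}_{2n+1}\setminus\{i,-i\}$, $f_i(i-1)=i$, $f_i(-(i-1))=-i$, and $f_i(a)=a$ otherwise; the endomorphism $g$ with $g(a)=a-1$ for $a>0$, $g(a)=a+1$ for $a<0$, $g(0)=0$; $\mathbf{0}$ is the constant given by the one-element subalgebra $\{0\}$; $\mathcal{T}$ is the discrete topology. "Alter ego" and "strong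 duality" are in the sense of natural duality theory (dual category $\mathbb{IS}_c\mathbb{P}^+$ of the alter ego, hom-functors into $\mathbf{Z}_{2n+1}$ and into the alter ego). *)

theory Defs
  imports "HOL-Analysis.Analysis"
begin

section \<open>Algebras, homomorphisms and ISP\<close>

text \<open>Every operation symbol has an arity given by a map \<open>ar\<close>; an operation takes its
  arguments as a list, and only lists of the right length over the universe matter.\<close>

record ('o, 'a) algebra =
  universe :: "'a set"
  op :: "'o \<Rightarrow> 'a list \<Rightarrow> 'a"

definition is_algebra :: "('o \<Rightarrow> nat) \<Rightarrow> ('o, 'a) algebra \<Rightarrow> bool" where
  "is_algebra ar A \<longleftrightarrow> universe A \<noteq> {} \<and>
     (\<forall>s xs. length xs = ar s \<and> set xs \<subseteq> universe A \<longrightarrow> op A s xs \<in> universe A)"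

definition subalg :: "('o, 'a) algebra \<Rightarrow> 'a set \<Rightarrow> ('o, 'a) algebra" where
  "subalg A S = A\<lparr>universe := S\<rparr>"

definition is_subuniverse :: "('o \<Rightarrow> nat) \<Rightarrow> 'a set \<Rightarrow> ('o, 'a) algebra \<Rightarrow> bool" where
  "is_subuniverse ar S A \<longleftrightarrow> S \<subseteq> universe A \<and> is_algebra ar (subalg A S)"

definition power_alg :: "('o, 'a) algebra \<Rightarrow> 'i set \<Rightarrow> ('o, 'i \<Rightarrow> 'a) algebra" where
  "power_alg M I =
     \<lparr>universe = (I \<rightarrow>\<^sub>E universe M),
      op = (\<lambda>s xs. \<lambda>i\<in>I. op M s (map (\<lambda>x. x i) xs))\<rparr>"

definition homs :: "('o \<Rightarrow> nat) \<Rightarrow> ('o, 'a) algebra \<Rightarrow> ('o, 'b) algebra \<Rightarrow> ('a \<Rightarrow> 'b) set" where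
  "homs ar A B = {h \<in> universe A \<rightarrow>\<^sub>E universe B.
     \<forall>s xs. length xs = ar s \<and> set xs \<subseteq> universe A \<longrightarrow> h (op A s xs) = op B s (map h xs)}"

definition alg_iso :: "('o \<Rightarrow> nat) \<Rightarrow> ('o, 'a) algebra \<Rightarrow> ('o, 'b) algebra \<Rightarrow> ('a \<Rightarrow> 'b) \<Rightarrow> bool" where
  "alg_iso ar A B h \<longleftrightarrow> h \<in> homs ar A B \<and> bij_betw h (universe A) (universe B)"

text \<open>The members of \<open>ISP(M)\<close> with elements of type \<open>'a\<close> that embed in a power whose index
  set is a set of elements of type \<open>'i\<close>.  HOL cannot quantify over types inside a formula,
  so the classes carry these types as parameters; a theorem with free type variables covers
  all of them.\<close>

definition ISP :: "('o \<Rightarrow> nat) \<Rightarrow> ('o, 'm) algebra \<Rightarrow> 'i itself \<Rightarrow> ('o, 'a) algebra set" where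
  "ISP ar M _ = {A. is_algebra ar A \<and>
     (\<exists>(I :: 'i set) S h. is_subuniverse ar S (power_alg M I) \<and>
        alg_iso ar A (subalg (power_alg M I) S) h)}"


section \<open>Topological structures with partial operations, and the class of closed substructures of powers\<close>

text \<open>A signature is a partial map \<open>\<Sigma>\<close> sending each symbol to its arity.  Total operations are
  partial operations with full domain and constants are total operations of arity 0:
  in powers and substructures total operations remain total, so they need no separate
  treatment.  An operation is undefined at \<open>xs\<close> if it returns \<open>None\<close> there.
  Relations are omitted, since the alter ego considered here has none.\<close>

record ('p, 'x) tstruct =
  topo :: "'x topology"
  pop :: "'p \<Rightarrow> 'x list \<Rightarrow> 'x option"

abbreviation points :: "('p, 'x) tstruct \<Rightarrow> 'x set" where
  "points X \<equiv> topspace (topo X)"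

definition is_tstruct :: "('p \<Rightarrow> nat option) \<Rightarrow> ('p, 'x) tstruct \<Rightarrow> bool" where
  "is_tstruct \<Sigma> X \<longleftrightarrow> (\<forall>s k xs y. \<Sigma> s = Some k \<and> pop X s xs = Some y \<longrightarrow>
     length xs = k \<and> set xs \<subseteq> points X \<and> y \<in> points X)"

definition closed_substr :: "('p \<Rightarrow> nat option) \<Rightarrow> 'x set \<Rightarrow> ('p, 'x) tstruct \<Rightarrow> bool" where
  "closed_substr \<Sigma> S X \<longleftrightarrow> closedin (topo X) S \<and>
     (\<forall>s\<in>dom \<Sigma>. \<forall>xs y. set xs \<subseteq> S \<and> pop X s xs = Some y \<longrightarrow> y \<in> S)"

definition substr :: "('p, 'x) tstruct \<Rightarrow> 'x set \<Rightarrow> ('p, 'x) tstruct" where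
  "substr X S =
     \<lparr>topo = subtopology (topo X) S,
      pop = (\<lambda>s xs. if set xs \<subseteq> S then pop X s xs else None)\<rparr>"

definition power_struct :: "('p, 'x) tstruct \<Rightarrow> 'i set \<Rightarrow> ('p, 'i \<Rightarrow> 'x) tstruct" where
  "power_struct X I =
     \<lparr>topo = product_topology (\<lambda>_. topo X) I,
      pop = (\<lambda>s xs.
        if set xs \<subseteq> (I \<rightarrow>\<^sub>E points X) \<and> (\<forall>i\<in>I. pop X s (map (\<lambda>x. x i) xs) \<noteq> None)
        then Some (\<lambda>i\<in>I. the (pop X s (map (\<lambda>x. x i) xs))) else None)\<rparr>"

definition morphs :: "('p \<Rightarrow> nat option) \<Rightarrow> ('p, 'x) tstruct \<Rightarrow> ('p, 'y) tstruct \<Rightarrow> ('x \<Rightarrow> 'y) set" where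
  "morphs \<Sigma> X Y = {\<phi> \<in> points X \<rightarrow>\<^sub>E points Y. continuous_map (topo X) (topo Y) \<phi> \<and>
     (\<forall>s\<in>dom \<Sigma>. \<forall>xs y. set xs \<subseteq> points X \<and> pop X s xs = Some y \<longrightarrow>
        pop Y s (map \<phi> xs) = Some (\<phi> y))}"

text \<open>Isomorphisms are homeomorphisms that preserve the partial operations and also reflect
  their domains.\<close>

definition struct_iso :: "('p \<Rightarrow> nat option) \<Rightarrow> ('p, 'x) tstruct \<Rightarrow> ('p, 'y) tstruct \<Rightarrow> ('x \<Rightarrow> 'y) \<Rightarrow> bool" where
  "struct_iso \<Sigma> X Y \<phi> \<longleftrightarrow> \<phi> \<in> morphs \<Sigma> X Y \<and> homeomorphic_map (topo X) (topo Y) \<phi> \<and>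
     (\<forall>s\<in>dom \<Sigma>. \<forall>xs. set xs \<subseteq> points X \<and> pop Y s (map \<phi> xs) \<noteq> None \<longrightarrow> pop X s xs \<noteq> None)"

definition struct_embedding :: "('p \<Rightarrow> nat option) \<Rightarrow> ('p, 'x) tstruct \<Rightarrow> ('p, 'y) tstruct \<Rightarrow> ('x \<Rightarrow> 'y) \<Rightarrow> bool" where
  "struct_embedding \<Sigma> X Y \<phi> \<longleftrightarrow>
     closed_substr \<Sigma> (\<phi> ` points X) Y \<and> struct_iso \<Sigma> X (substr Y (\<phi> ` points X)) \<phi>"

text \<open>The class \<open>IS\<^sub>cP\<^sup>+\<close>: isomorphic copies of closed substructures of powers with nonempty
  index set; the type parameters are as for \<open>ISP\<close>.\<close>

definition IScP :: "('p \<Rightarrow> nat option) \<Rightarrow> ('p, 'm) tstruct \<Rightarrow> 'i itself \<Rightarrow> ('p, 'x) tstruct set" where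
  "IScP \<Sigma> Mt _ = {X. is_tstruct \<Sigma> X \<and>
     (\<exists>(I :: 'i set) S \<phi>. I \<noteq> {} \<and> closed_substr \<Sigma> S (power_struct Mt I) \<and>
        struct_iso \<Sigma> X (substr (power_struct Mt I) S) \<phi>)}"


section \<open>Natural dualities\<close>

text \<open>A \<open>k\<close>-tuple \<open>t\<close> in the power of \<open>M\<close> with index set \<open>{..<k}\<close> is passed to a \<open>k\<close>-ary partial
  operation as the list \<open>map t [0..<k]\<close>.  Each partial operation has to be a homomorphism into
  \<open>M\<close> from a subalgebra of a finite power of \<open>M\<close>.\<close>

definition is_alter_ego :: "('o \<Rightarrow> nat) \<Rightarrow> ('p \<Rightarrow> nat option) \<Rightarrow> ('o, 'm) algebra \<Rightarrow> ('p, 'm) tstruct \<Rightarrow> bool" where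
  "is_alter_ego ar \<Sigma> M Mt \<longleftrightarrow>
     is_algebra ar M \<and> finite (universe M) \<and>
     topo Mt = discrete_topology (universe M) \<and> is_tstruct \<Sigma> Mt \<and>
     (\<forall>s k. \<Sigma> s = Some k \<longrightarrow>
        (let D = {t \<in> {..<k} \<rightarrow>\<^sub>E universe M. pop Mt s (map t [0..<k]) \<noteq> None}
         in is_subuniverse ar D (power_alg M {..<k}) \<and>
            (\<lambda>t\<in>D. the (pop Mt s (map t [0..<k]))) \<in> homs ar (subalg (power_alg M {..<k}) D) M))"

definition dual_space :: "('o \<Rightarrow> nat) \<Rightarrow> ('o, 'm) algebra \<Rightarrow> ('p, 'm) tstruct \<Rightarrow> ('o, 'a) algebra
    \<Rightarrow> ('p, 'a \<Rightarrow> 'm) tstruct" where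
  "dual_space ar M Mt A = substr (power_struct Mt (universe A)) (homs ar A M)"

definition dual_alg :: "('p \<Rightarrow> nat option) \<Rightarrow> ('o, 'm) algebra \<Rightarrow> ('p, 'm) tstruct \<Rightarrow> ('p, 'x) tstruct
    \<Rightarrow> ('o, 'x \<Rightarrow> 'm) algebra" where
  "dual_alg \<Sigma> M Mt X = subalg (power_alg M (points X)) (morphs \<Sigma> X Mt)"

definition eval_alg :: "('o \<Rightarrow> nat) \<Rightarrow> ('o, 'm) algebra \<Rightarrow> ('o, 'a) algebra \<Rightarrow> 'a \<Rightarrow> ('a \<Rightarrow> 'm) \<Rightarrow> 'm" where
  "eval_alg ar M A = (\<lambda>a\<in>universe A. \<lambda>h\<in>homs ar A M. h a)"

definition eval_space :: "('p \<Rightarrow> nat option) \<Rightarrow> ('p, 'm) tstruct \<Rightarrow> ('p, 'x) tstruct \<Rightarrow> 'x \<Rightarrow> ('x \<Rightarrow> 'm) \<Rightarrow> 'm" where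
  "eval_space \<Sigma> Mt X = (\<lambda>x\<in>points X. \<lambda>\<phi>\<in>morphs \<Sigma> X Mt. \<phi> x)"

definition yields_duality :: "('o \<Rightarrow> nat) \<Rightarrow> ('p \<Rightarrow> nat option) \<Rightarrow> ('o, 'm) algebra \<Rightarrow> ('p, 'm) tstruct
    \<Rightarrow> 'a itself \<Rightarrow> 'i itself \<Rightarrow> bool" where
  "yields_duality ar \<Sigma> M Mt _ _ \<longleftrightarrow>
     (\<forall>A :: ('o, 'a) algebra. A \<in> ISP ar M TYPE('i) \<longrightarrow>
        alg_iso ar A (dual_alg \<Sigma> M Mt (dual_space ar M Mt A)) (eval_alg ar M A))"

definition yields_full_duality :: "('o \<Rightarrow> nat) \<Rightarrow> ('p \<Rightarrow> nat option) \<Rightarrow> ('o, 'm) algebra \<Rightarrow> ('p, 'm) tstruct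
    \<Rightarrow> 'a itself \<Rightarrow> 'x itself \<Rightarrow> 'i itself \<Rightarrow> bool" where
  "yields_full_duality ar \<Sigma> M Mt _ _ _ \<longleftrightarrow>
     yields_duality ar \<Sigma> M Mt TYPE('a) TYPE('i) \<and>
     (\<forall>X :: ('p, 'x) tstruct. X \<in> IScP \<Sigma> Mt TYPE('i) \<longrightarrow>
        struct_iso \<Sigma> X (dual_space ar M Mt (dual_alg \<Sigma> M Mt X)) (eval_space \<Sigma> Mt X))"

text \<open>Injectivity of \<open>Mt\<close> in its dual category with respect to embeddings.  It is no
  restriction that \<open>X\<close> and \<open>Y\<close> have points of the same type \<open>'x\<close>: two structures with
  different point types have isomorphic copies over the sum type.\<close>

definition injective_in_IScP :: "('p \<Rightarrow> nat option) \<Rightarrow> ('p, 'm) tstruct \<Rightarrow> 'x itself \<Rightarrow> 'i itself \<Rightarrow> bool" where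
  "injective_in_IScP \<Sigma> Mt _ _ \<longleftrightarrow>
     (\<forall>(X :: ('p, 'x) tstruct) (Y :: ('p, 'x) tstruct) \<phi> \<alpha>.
        X \<in> IScP \<Sigma> Mt TYPE('i) \<and> Y \<in> IScP \<Sigma> Mt TYPE('i) \<and>
        struct_embedding \<Sigma> X Y \<phi> \<and> \<alpha> \<in> morphs \<Sigma> X Mt \<longrightarrow>
        (\<exists>\<beta>\<in>morphs \<Sigma> Y Mt. \<forall>x\<in>points X. \<beta> (\<phi> x) = \<alpha> x))"

text \<open>A strong duality is a full duality whose alter ego is injective in the dual category.\<close>

definition yields_strong_duality :: "('o \<Rightarrow> nat) \<Rightarrow> ('p \<Rightarrow> nat option) \<Rightarrow> ('o, 'm) algebra \<Rightarrow> ('p, 'm) tstruct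
    \<Rightarrow> 'a itself \<Rightarrow> 'x itself \<Rightarrow> 'i itself \<Rightarrow> bool" where
  "yields_strong_duality ar \<Sigma> M Mt _ _ _ \<longleftrightarrow>
     yields_full_duality ar \<Sigma> M Mt TYPE('a) TYPE('x) TYPE('i) \<and>
     injective_in_IScP \<Sigma> Mt TYPE('x) TYPE('i)"


section \<open>The odd Sugihara algebras and their alter egos\<close>

datatype sug_op = Meet | Join | Imp | Neg

fun sug_arity :: "sug_op \<Rightarrow> nat" where
  "sug_arity Meet = 2"
| "sug_arity Join = 2"
| "sug_arity Imp = 2"
| "sug_arity Neg = 1"

definition sug_imp :: "int \<Rightarrow> int \<Rightarrow> int" where
  "sug_imp a b = (if a \<le> b then max (- a) b else min (- a) b)"

fun sug_interp :: "sug_op \<Rightarrow> int list \<Rightarrow> int" where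
  "sug_interp Meet [a, b] = min a b"
| "sug_interp Join [a, b] = max a b"
| "sug_interp Imp [a, b] = sug_imp a b"
| "sug_interp Neg [a] = - a"
| "sug_interp _ _ = undefined"

definition Z_alg :: "(sug_op, int) algebra" where
  "Z_alg = \<lparr>universe = UNIV, op = sug_interp\<rparr>"

text \<open>The subalgebra with \<open>2n+1\<close> elements.\<close>

definition Z_odd :: "nat \<Rightarrow> (sug_op, int) algebra" where
  "Z_odd n = subalg Z_alg {- int n..int n}"

datatype ego_sym = F nat | G | Zero

text \<open>\<open>F i\<close> is a symbol only for \<open>i \<le> n\<close>.\<close>

fun ego_sig :: "nat \<Rightarrow> ego_sym \<Rightarrow> nat option" where
  "ego_sig n (F i) = (if i \<le> n then Some 1 else None)"
| "ego_sig n G = Some 1"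
| "ego_sig n Zero = Some 0"

definition f_part :: "nat \<Rightarrow> int \<Rightarrow> int option" where
  "f_part i a =
     (if a = int i \<or> a = - int i then None
      else if i > 1 \<and> a = int i - 1 then Some (int i)
      else if i > 1 \<and> a = - (int i - 1) then Some (- int i)
      else Some a)"

definition g_map :: "int \<Rightarrow> int" where
  "g_map a = (if a > 0 then a - 1 else if a < 0 then a + 1 else 0)"

fun ego_interp :: "ego_sym \<Rightarrow> int list \<Rightarrow> int option" where
  "ego_interp (F i) [a] = f_part i a"
| "ego_interp G [a] = Some (g_map a)"
| "ego_interp Zero [] = Some 0"
| "ego_interp _ _ = None"

definition Z_ego :: "nat \<Rightarrow> (ego_sym, int) tstruct" where
  "Z_ego n = substr \<lparr>topo = discrete_topology UNIV, pop = ego_interp\<rparr> {- int n..int n}"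

end

theory Submission
  imports Defs
begin

text \<open>
  The partial endomorphisms \<open>f\<^sub>2, \<dots>, f\<^sub>n\<close> and \<open>g\<close> generate by composition all homomorphisms from
  subalgebras of \<open>\<^bold>Z\<^sub>2\<^sub>n\<^sub>+\<^sub>1\<close> into it: such a homomorphism collapses a symmetric interval to \<open>0\<close> and is
  injective elsewhere, so it arises by pushing all elements away from \<open>0\<close>, shrinking with \<open>g\<close>, and
  pushing again.  Moreover, every subalgebra of the square is the pullback of two such homomorphisms.

  Let \<open>X\<close> be a compact substructure of the dual space of an algebra \<open>A\<close>.  A morphism from \<open>X\<close>
  to the alter ego preserves all partial endomorphisms, so it satisfies the pullback condition; since the
  domains of the \<open>f\<^sub>i\<close> omit exactly \<open>\<plusminus>i\<close>, its value at a point also lies in the image of that point.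
  Hence it agrees at any two points with an element of \<open>A\<close>.  Gluing by lattice operations and compactness, as in the
  lattice form of the Stone--Weierstrass theorem, shows that it is evaluation at an element of \<open>A\<close>.
  This gives the duality (\<open>X\<close> the whole dual space) and injectivity (\<open>A\<close> the dual algebra of a
  larger structure).  For fullness, a homomorphism \<open>u\<close> from \<open>A\<close> has a kernel containing that of
  some point \<open>x\<close>, so \<open>u\<close> factors through \<open>x\<close> by a partial endomorphism and is itself a point.
\<close>

section \<open>Partial endomorphisms and subalgebras of the square\<close>

text \<open>On a subuniverse \<open>B\<close> these are the homomorphisms into the algebra, in terms
  of order: monotonicity takes care of meet and join, and implication forbids identifying two
  elements except at the value 0.\<close>

definition odd_hom :: "nat \<Rightarrow> int set \<Rightarrow> (int \<Rightarrow> int) \<Rightarrow> bool" where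
  "odd_hom n B h \<longleftrightarrow> (\<forall>b\<in>B. \<bar>h b\<bar> \<le> int n \<and> h (- b) = - h b) \<and>
     (\<forall>a\<in>B. \<forall>b\<in>B. a < b \<longrightarrow> h a < h b \<or> h a = 0 \<and> h b = 0)"

text \<open>\<open>gen_F\<close> composes only if the whole image of \<open>B\<close> lies in the
  domain, as partial operations do in a power. Only values on \<open>B\<close> count, hence
  \<open>gen_cong\<close>.\<close>

inductive generated :: "nat \<Rightarrow> int set \<Rightarrow> (int \<Rightarrow> int) \<Rightarrow> bool" for n B where
  gen_id: "generated n B (\<lambda>a. a)"
| gen_F: "generated n B h \<Longrightarrow> i \<le> n \<Longrightarrow> (\<And>b. b \<in> B \<Longrightarrow> f_part i (h b) \<noteq> None) \<Longrightarrow>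
    generated n B (\<lambda>b. the (f_part i (h b)))"
| gen_G: "generated n B h \<Longrightarrow> generated n B (\<lambda>b. g_map (h b))"
| gen_cong: "generated n B h \<Longrightarrow> (\<And>b. b \<in> B \<Longrightarrow> h b = h' b) \<Longrightarrow> generated n B h'"

text \<open>Outward moves are undone one at a time. If \<open>c\<close> is the least value at which
  \<open>h\<close> exceeds a positive value of \<open>k\<close>, then \<open>c - 1\<close> is free,
  so \<open>h\<close> is \<open>F c\<close> after the map \<open>h'\<close> that pulls
  \<open>c\<close> and \<open>- c\<close> inward. \<open>h'\<close> still dominates
  \<open>k\<close>, and its sum of absolute values is smaller.\<close>

lemma generated_expand:
  assumes "finite B" and sym: "\<And>b. b \<in> B \<Longrightarrow> - b \<in> B"
    and gen: "generated n B k" and k: "odd_hom n B k" and "odd_hom n B h"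
    and "\<And>b. b \<in> B \<Longrightarrow> k b > 0 \<Longrightarrow> k b \<le> h b"
    and "\<And>b. b \<in> B \<Longrightarrow> k b = 0 \<Longrightarrow> h b = 0"
  shows "generated n B h"
  using assms(5-)
proof (induction "\<Sum>b\<in>B. nat \<bar>h b\<bar>" arbitrary: h rule: less_induct)
  case less
  note h = less.prems(1) and ge = less.prems(2) and z = less.prems(3)
  let ?T = "{b \<in> B. k b > 0 \<and> k b < h b}"
  show ?case
  proof (cases "?T = {}")
    case True
    have "k b = h b" if b: "b \<in> B" for b
    proof -
      have *: "k c = h c" if "c \<in> B" "k c > 0" for c using True ge[OF that] that by force
      have "k (- b) = - k b" "h (- b) = - h b" using k h b by (auto simp: odd_hom_def)
      then show ?thesis using *[OF b] *[OF sym[OF b]] z[OF b] by linarith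
    qed
    then show ?thesis using gen gen_cong by blast
  next
    case False
    have "finite ?T" using assms(1) by simp
    then obtain b0 where b0: "b0 \<in> ?T" and mn: "\<And>b. b \<in> ?T \<Longrightarrow> h b0 \<le> h b"
      using False by (metis (no_types, lifting) arg_min_if_finite(1) arg_min_least)
    define c where "c = h b0"
    \<comment> \<open>\<open>c\<close> exceeds the positive value \<open>k b0\<close>; from 2 on,
      \<open>F c\<close> really moves a value.\<close>
    have c2: "c \<ge> 2" using b0 c_def by auto
    have cn: "c \<le> int n" using b0 h c_def by (auto simp: odd_hom_def)
    define h' where "h' b = (if h b = c then c - 1 else if h b = - c then - (c - 1) else h b)" for b
    \<comment> \<open>If \<open>h b = c - 1\<close>, then \<open>b < b0\<close>, and minimality of
      \<open>c\<close> forces \<open>k b = c - 1\<close>; but \<open>k b < k b0 < c\<close> leaves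
      no room.\<close>
    have gap: "h b \<noteq> c - 1" if b: "b \<in> B" for b
    proof
      assume e: "h b = c - 1"
      have "b < b0"
      proof (rule ccontr)
        assume "\<not> b < b0"
        moreover have "b \<noteq> b0" using e c_def by auto
        ultimately have "b0 < b" by simp
        then have "h b0 < h b \<or> h b0 = 0" using h b b0 by (auto simp: odd_hom_def)
        then show False using e c_def c2 by auto
      qed
      moreover have "k b > 0"
      proof (rule ccontr)
        assume "\<not> k b > 0"
        then have "k b < 0" using z[OF b] e c2 by (cases "k b = 0") auto
        then have "k (- b) > 0" "- b \<in> B" using k b sym by (auto simp: odd_hom_def)
        then have "h (- b) > 0" using ge by force
        then show False using h b e c2 by (auto simp: odd_hom_def)
      qed
      ultimately have "k b = h b" using mn[of b] ge[OF b] b e c_def by force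
      moreover have "k b < k b0" using k b b0 \<open>b < b0\<close> \<open>k b > 0\<close> by (force simp: odd_hom_def)
      ultimately show False using b0 e c_def by auto
    qed
    have gap': "h b \<noteq> - (c - 1)" if b: "b \<in> B" for b
      using gap[OF sym[OF b]] h b by (auto simp: odd_hom_def)
    have odd: "odd_hom n B h'"
      unfolding odd_hom_def
    proof (intro conjI ballI impI)
      fix b assume b: "b \<in> B"
      have *: "\<bar>h b\<bar> \<le> int n" "h (- b) = - h b" using h b by (auto simp: odd_hom_def)
      show "\<bar>h' b\<bar> \<le> int n" using * c2 by (auto simp: h'_def)
      show "h' (- b) = - h' b" using * c2 by (auto simp: h'_def)
    next
      fix a b assume ab: "a \<in> B" "b \<in> B" "a < b"
      then have "h a < h b \<or> h a = 0 \<and> h b = 0" using h by (auto simp: odd_hom_def)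
      then show "h' a < h' b \<or> h' a = 0 \<and> h' b = 0"
        using gap[OF ab(1)] gap'[OF ab(2)] gap[OF ab(2)] gap'[OF ab(1)] c2 by (auto simp: h'_def)
    qed
    have "generated n B h'"
    proof (rule less.hyps[OF _ odd])
      show "(\<Sum>b\<in>B. nat \<bar>h' b\<bar>) < (\<Sum>b\<in>B. nat \<bar>h b\<bar>)"
      proof (rule sum_strict_mono_ex1[OF assms(1)])
        show "\<forall>x\<in>B. nat \<bar>h' x\<bar> \<le> nat \<bar>h x\<bar>" using c2 by (auto simp: h'_def)
        show "\<exists>a\<in>B. nat \<bar>h' a\<bar> < nat \<bar>h a\<bar>"
          using b0 c2 c_def by (intro bexI[of _ b0]) (auto simp: h'_def)
      qed
      show "k b \<le> h' b" if "b \<in> B" "k b > 0" for b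
      proof (cases "h b = c")
        case True
        then have "b = b0" using h that(1) b0 c_def c2
          unfolding odd_hom_def by (smt (verit) mem_Collect_eq)
        then show ?thesis using b0 c_def by (auto simp: h'_def)
      next
        case False
        then show ?thesis using ge[OF that] that c2 by (auto simp: h'_def)
      qed
      show "h' b = 0" if "b \<in> B" "k b = 0" for b
        using z[OF that] c2 by (auto simp: h'_def)
    qed
    then have "generated n B (\<lambda>b. the (f_part (nat c) (h' b)))"
    proof (rule gen_F)
      show "nat c \<le> n" using cn by simp
      show "f_part (nat c) (h' b) \<noteq> None" if "b \<in> B" for b
        using c2 by (auto simp: f_part_def h'_def)
    qed
    then show ?thesis
      by (rule gen_cong) (use c2 gap gap' in \<open>auto simp: f_part_def h'_def\<close>)
  qed
qed

lemma generated_g_power: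
  "generated n B h \<Longrightarrow> generated n B (\<lambda>b. sgn (h b) * max 0 (\<bar>h b\<bar> - int k))"
proof (induction k)
  case 0
  then show ?case by (rule gen_cong) (auto simp: sgn_mult_abs)
next
  case (Suc k)
  from gen_G[OF Suc.IH[OF Suc.prems]] show ?case
    by (rule gen_cong) (auto simp: g_map_def sgn_if)
qed

text \<open>Three stages: \<open>e\<close> packs \<open>B\<close> against the outer ends, a power of
  \<open>G\<close> then kills exactly the elements that \<open>h\<close> sends to 0, and the result
  \<open>q\<close>, being smallest possible on the rest, is expanded to \<open>h\<close>.\<close>

theorem odd_hom_generated:
  assumes B: "B \<subseteq> {- int n..int n}" and sym: "\<And>b. b \<in> B \<Longrightarrow> - b \<in> B"
    and h: "odd_hom n B h"
  shows "generated n B h"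
proof -
  have fin: "finite B" using B finite_subset by blast
  \<comment> \<open>\<open>above\<close> ranks elements from the top, so \<open>e\<close> sends the
    positive elements of \<open>B\<close>, largest first, to \<open>n\<close>, \<open>n - 1\<close>
    and so on.\<close>
  define above where "above b = card {d \<in> B. d > b}" for b
  define e where "e b = sgn b * (int n - int (above \<bar>b\<bar>))" for b
  have absB: "\<bar>b\<bar> \<in> B" if "b \<in> B" for b using sym[OF that] that by (auto simp: abs_if)
  have hpos: "h b \<ge> 0" if "b \<in> B" "b > 0" for b
    using h that sym[OF that(1)] unfolding odd_hom_def by (smt (verit))
  have h0: "h b = 0" if "b \<in> B" "b = 0" for b
    using h that unfolding odd_hom_def by force
  have above_le: "int (above b) \<le> int n - b" if "0 \<le> b" "b \<le> int n" for b
  proof -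
    have "above b \<le> card {b<..int n}"
      unfolding above_def using B by (intro card_mono) auto
    then show ?thesis using that by simp
  qed
  have above_less: "above b < above a" if "b \<in> B" "a < b" for a b
    unfolding above_def using that fin by (intro psubset_card_mono) auto
  have e: "odd_hom n B e"
    unfolding odd_hom_def
  proof (intro conjI ballI impI)
    fix b assume b: "b \<in> B"
    then have "int (above \<bar>b\<bar>) \<le> int n" using above_le[of "\<bar>b\<bar>"] B by force
    then show "\<bar>e b\<bar> \<le> int n" by (auto simp: e_def sgn_if)
    show "e (- b) = - e b" by (simp add: e_def sgn_if)
  next
    fix a b assume ab: "a \<in> B" "b \<in> B" "a < b"
    have *: "int (above \<bar>c\<bar>) \<le> int n - \<bar>c\<bar>" if "c \<in> B" for c
      using above_le[of "\<bar>c\<bar>"] B that by force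
    have "above \<bar>b\<bar> < above \<bar>a\<bar>" if "a > 0" using above_less[OF absB[OF ab(2)]] ab that by simp
    moreover have "above \<bar>a\<bar> < above \<bar>b\<bar>" if "b < 0" using above_less[OF absB[OF ab(1)]] ab that by simp
    ultimately show "e a < e b \<or> e a = 0 \<and> e b = 0"
      using *[OF ab(1)] *[OF ab(2)] ab(3) by (auto simp: e_def sgn_if)
  qed
  have "generated n B e"
  proof (rule generated_expand[OF fin sym gen_id _ e])
    show "odd_hom n B (\<lambda>a. a)" using B by (force simp: odd_hom_def)
    show "b \<le> e b" if "b \<in> B" "0 < b" for b
      using above_le[of b] that B by (auto simp: e_def)
  qed (auto simp: e_def)
  \<comment> \<open>The \<open>r\<close> elements with positive image are the top ones, with packed
    values \<open>n - r + 1\<close> to \<open>n\<close>; so \<open>n - r\<close> applications of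
    \<open>G\<close> take them to 1 up to \<open>r\<close>.\<close>
  define r where "r = card {d \<in> B. h d > 0}"
  have hpos': "d > 0" if "d \<in> B" "h d > 0" for d
    using h that sym[OF that(1)] unfolding odd_hom_def by (smt (verit))
  have rn: "r \<le> n"
  proof -
    have "r \<le> card {0<..int n}"
      unfolding r_def using hpos' B by (intro card_mono) auto
    then show ?thesis by simp
  qed
  define q where "q b = sgn (e b) * max 0 (\<bar>e b\<bar> - int (n - r))" for b
  have q: "q b = max 0 (int r - int (above b))" if "b \<in> B" "b > 0" for b
    using above_le[of b] that B rn by (auto simp: q_def e_def sgn_if)
  have q_odd: "q (- b) = - q b" for b by (simp add: q_def e_def)
  have q0: "q 0 = 0" by (simp add: q_def e_def)
  \<comment> \<open>\<open>q b\<close> counts the elements up to \<open>b\<close> with positive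
    image; \<open>h\<close> maps them injectively into the integers from 1 to
    \<open>h b\<close>.\<close>
  have qpos: "0 < q b \<and> q b \<le> h b" if "b \<in> B" "h b > 0" for b
  proof -
    let ?U = "{d \<in> B. d \<le> b \<and> h d > 0}"
    have "{d \<in> B. h d > 0} = {d \<in> B. d > b} \<union> ?U"
      using h that unfolding odd_hom_def by (smt (verit) Collect_cong Un_def mem_Collect_eq)
    then have "r = above b + card ?U"
      unfolding r_def above_def using fin by (simp add: card_Un_disjoint disjoint_iff)
    moreover have "card ?U > 0" using that fin by (auto simp: card_gt_0_iff)
    moreover have "card ?U \<le> card {0<..h b}"
    proof (rule card_inj_on_le[of h])
      show "inj_on h ?U"
        using h unfolding inj_on_def odd_hom_def by (smt (verit) mem_Collect_eq)
      show "h ` ?U \<subseteq> {0<..h b}" using h that unfolding odd_hom_def by force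
    qed simp
    ultimately show ?thesis using q[of b] hpos'[OF that] that by auto
  qed
  have qz: "q b = 0" if "b \<in> B" "b > 0" "h b = 0" for b
  proof -
    have "r \<le> above b"
      unfolding r_def above_def
    proof (rule card_mono)
      show "{d \<in> B. h d > 0} \<subseteq> {d \<in> B. d > b}"
      proof safe
        fix d assume d: "d \<in> B" "h d > 0"
        then show "d > b" using h that unfolding odd_hom_def
          by (metis (no_types, lifting) less_irrefl not_less_iff_gr_or_eq order_less_trans)
      qed
    qed (use fin in simp)
    then show ?thesis using q[OF that(1,2)] by simp
  qed
  have h_odd: "h (- b) = - h b" if "b \<in> B" for b using h that by (auto simp: odd_hom_def)
  have pos: "h b > 0 \<and> q b > 0 \<or> h b = 0 \<and> q b = 0" if "b \<in> B" "b > 0" for b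
    using hpos[OF that] qpos[OF that(1)] qz[OF that] by linarith
  have qh: "(q b > 0 \<longrightarrow> h b > 0) \<and> (q b = 0 \<longrightarrow> h b = 0)" if b: "b \<in> B" for b
  proof -
    consider "b > 0" | "b = 0" | "- b > 0" by linarith
    then show ?thesis
    proof cases
      case 1
      then show ?thesis using pos[OF b] by linarith
    next
      case 2
      then show ?thesis using h0[OF b] q0 by simp
    next
      case 3
      then show ?thesis using pos[OF sym[OF b]] h_odd[OF b] q_odd[of b] by linarith
    qed
  qed
  have gq: "generated n B q"
    unfolding q_def by (rule generated_g_power) fact
  have oq: "odd_hom n B q"
    unfolding odd_hom_def
  proof (intro conjI ballI impI)
    fix b assume b: "b \<in> B"
    have "\<bar>e b\<bar> \<le> int n" using e b by (auto simp: odd_hom_def)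
    then show "\<bar>q b\<bar> \<le> int n" by (auto simp: q_def sgn_if)
    show "q (- b) = - q b" by (rule q_odd)
  next
    fix a b assume ab: "a \<in> B" "b \<in> B" "a < b"
    then have "e a < e b \<or> e a = 0 \<and> e b = 0" using e by (auto simp: odd_hom_def)
    then show "q a < q b \<or> q a = 0 \<and> q b = 0" by (auto simp: q_def sgn_if)
  qed
  show ?thesis
    using qh qpos by (intro generated_expand[OF fin sym gq oq h]) auto
qed

section \<open>Subalgebras of the square as pullbacks\<close>

definition pair_alg :: "(int \<times> int) set \<Rightarrow> bool" where
  "pair_alg S \<longleftrightarrow> (\<forall>a b. (a, b) \<in> S \<longrightarrow> (- a, - b) \<in> S) \<and>
     (\<forall>a b c d. (a, b) \<in> S \<and> (c, d) \<in> S \<longrightarrow>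
        (min a c, min b d) \<in> S \<and> (max a c, max b d) \<in> S \<and> (sug_imp a c, sug_imp b d) \<in> S)"

text \<open>If \<open>S\<close> is to be described by \<open>h a = k b\<close> with \<open>k\<close>
  odd, these elements must go to 0, since \<open>k b = k (- b)\<close>.\<close>

definition split_dom :: "(int \<times> int) set \<Rightarrow> int set" where
  "split_dom S = {a. \<exists>b. (a, b) \<in> S \<and> (a, - b) \<in> S}"

lemma pair_alg_converse: "pair_alg S \<Longrightarrow> pair_alg (S\<inverse>)"
  by (auto simp: pair_alg_def)

text \<open>The last rule is for fusion, the De Morgan dual of implication. In a fusion the argument
  of strictly larger absolute value wins; the same holds for implication once its first argument is
  negated.\<close>

lemma pair_algD:
  assumes "pair_alg S" "(a, b) \<in> S"
  shows "(- a, - b) \<in> S"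
    and "(c, d) \<in> S \<Longrightarrow> (min a c, min b d) \<in> S"
    and "(c, d) \<in> S \<Longrightarrow> (max a c, max b d) \<in> S"
    and "(c, d) \<in> S \<Longrightarrow> (sug_imp a c, sug_imp b d) \<in> S"
    and "(c, d) \<in> S \<Longrightarrow> (- sug_imp a (- c), - sug_imp b (- d)) \<in> S"
  using assms unfolding pair_alg_def by blast+

lemma split_signs:
  assumes "pair_alg S" "(a, b) \<in> S" "(a, - b) \<in> S"
  shows "(\<bar>a\<bar>, \<bar>b\<bar>) \<in> S" "(- \<bar>a\<bar>, \<bar>b\<bar>) \<in> S" "(\<bar>a\<bar>, - \<bar>b\<bar>) \<in> S" "(- \<bar>a\<bar>, - \<bar>b\<bar>) \<in> S"
  using assms pair_algD(1)[OF assms(1,2)] pair_algD(1)[OF assms(1,3)] by (auto simp: abs_if)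

text \<open>The pair \<open>(a, c)\<close> is combined with pairs from \<open>split_signs\<close> so
  that \<open>c\<close> survives while the first coordinate becomes \<open>\<bar>a\<bar>\<close> or
  \<open>- \<bar>a\<bar>\<close>. Join and meet achieve this if
  \<open>\<bar>c\<bar> \<le> \<bar>b\<bar>\<close>; otherwise implication and fusion do, because
  \<open>c\<close> then has the larger absolute value.\<close>

lemma split_dom_converse:
  assumes S: "pair_alg S" and ac: "(a, c) \<in> S" and "a \<in> split_dom S"
  shows "c \<in> split_dom (S\<inverse>)"
proof -
  obtain b where "(a, b) \<in> S" "(a, - b) \<in> S" using assms by (auto simp: split_dom_def)
  note s = split_signs[OF S this]
  have "(\<bar>a\<bar>, c) \<in> S \<and> (- \<bar>a\<bar>, c) \<in> S"
  proof (cases "\<bar>c\<bar> \<le> \<bar>b\<bar>")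
    case True
    have "min a (- \<bar>a\<bar>) = - \<bar>a\<bar>" "max a \<bar>a\<bar> = \<bar>a\<bar>" "min c \<bar>b\<bar> = c" "max c (- \<bar>b\<bar>) = c"
      using True by linarith+
    then show ?thesis
      using pair_algD(2)[OF S ac s(2)] pair_algD(3)[OF S ac s(3)] by simp
  next
    case False
    have *: "sug_imp (- a) \<bar>a\<bar> = \<bar>a\<bar>" "- sug_imp (a) (- (- \<bar>a\<bar>)) = - \<bar>a\<bar>"
      "sug_imp (- c) \<bar>b\<bar> = c" "- sug_imp (c) (- \<bar>b\<bar>) = c"
      using False by (auto simp: sug_imp_def)
    have "(- a, - c) \<in> S" using pair_algD(1)[OF S ac] .
    then show ?thesis
      using pair_algD(4)[OF S _ s(1), of "- a" "- c"] pair_algD(5)[OF S ac s(2)] *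
      by simp
  qed
  then show ?thesis by (cases "a \<ge> 0") (auto simp: split_dom_def)
qed

text \<open>\<open>S\<close> contains \<open>a\<close> paired with \<open>\<bar>b\<bar>\<close> and
  \<open>- \<bar>b\<bar>\<close>, and \<open>c\<close> paired with \<open>\<bar>d\<bar>\<close> and
  \<open>- \<bar>d\<bar>\<close>. Comparing absolute values in each coordinate tells which of meet,
  join and implication keeps \<open>a\<close> on the left and \<open>c\<close> on the right.\<close>

lemma split_dom_rect:
  assumes S: "pair_alg S" and "a \<in> split_dom S" "c \<in> split_dom (S\<inverse>)"
  shows "(a, c) \<in> S"
proof -
  obtain b where "(a, b) \<in> S" "(a, - b) \<in> S" using assms by (auto simp: split_dom_def)
  note s = split_signs[OF S this]
  obtain d where "(d, c) \<in> S" "(- d, c) \<in> S" using assms by (auto simp: split_dom_def)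
  then have t: "(\<bar>d\<bar>, \<bar>c\<bar>) \<in> S" "(\<bar>d\<bar>, - \<bar>c\<bar>) \<in> S" "(- \<bar>d\<bar>, \<bar>c\<bar>) \<in> S" "(- \<bar>d\<bar>, - \<bar>c\<bar>) \<in> S"
    using split_signs[OF pair_alg_converse[OF S], of c d] by auto
  have t': "(\<bar>d\<bar>, c) \<in> S" "(- \<bar>d\<bar>, c) \<in> S" using t by (cases "c \<ge> 0"; simp)+
  have s': "(a, \<bar>b\<bar>) \<in> S" "(a, - \<bar>b\<bar>) \<in> S" using s by (cases "a \<ge> 0"; simp)+
  consider "\<bar>c\<bar> \<le> \<bar>b\<bar>" "\<bar>a\<bar> \<le> \<bar>d\<bar>" | "\<bar>c\<bar> > \<bar>b\<bar>" "\<bar>a\<bar> > \<bar>d\<bar>"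
    | "\<bar>c\<bar> \<le> \<bar>b\<bar>" "\<bar>a\<bar> > \<bar>d\<bar>" | "\<bar>c\<bar> > \<bar>b\<bar>" "\<bar>a\<bar> \<le> \<bar>d\<bar>" by linarith
  then show ?thesis
  proof cases
    case 1
    then have "min a \<bar>d\<bar> = a" "min \<bar>b\<bar> c = c" by linarith+
    then show ?thesis using pair_algD(2)[OF S s'(1) t'(1)] by simp
  next
    case 2
    then have "sug_imp (- a) \<bar>d\<bar> = a" "sug_imp (- \<bar>b\<bar>) c = c"
      by (auto simp: sug_imp_def)
    moreover have "(- a, - \<bar>b\<bar>) \<in> S" using pair_algD(1)[OF S s'(1)] .
    ultimately show ?thesis using pair_algD(4)[OF S _ t'(1), of "- a" "- \<bar>b\<bar>"] by simp
  next
    case 3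
    show ?thesis
    proof (cases "a \<ge> 0")
      case True
      then have "max a \<bar>d\<bar> = a" "max (- \<bar>b\<bar>) c = c" using 3 by linarith+
      then show ?thesis using pair_algD(3)[OF S s'(2) t'(1)] by simp
    next
      case False
      then have "min a \<bar>d\<bar> = a" "min \<bar>b\<bar> c = c" using 3 by linarith+
      then show ?thesis using pair_algD(2)[OF S s'(1) t'(1)] by simp
    qed
  next
    case 4
    show ?thesis
    proof (cases "c \<ge> 0")
      case True
      then have "max a (- \<bar>d\<bar>) = a" "max \<bar>b\<bar> c = c" using 4 by linarith+
      then show ?thesis using pair_algD(3)[OF S s'(1) t'(2)] by simp
    next
      case False
      then have "min a \<bar>d\<bar> = a" "min \<bar>b\<bar> c = c" using 4 by linarith+
      then show ?thesis using pair_algD(2)[OF S s'(1) t'(1)] by simp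
    qed
  qed
qed

text \<open>Two partners \<open>b < c\<close> of \<open>a\<close>, combined by implication in both
  orders, give \<open>\<bar>a\<bar>\<close> two opposite partners, so \<open>a\<close> would be
  split.\<close>

lemma nonsplit_unique:
  assumes S: "pair_alg S" and a: "a \<notin> split_dom S" and "(a, b) \<in> S" "(a, c) \<in> S"
  shows "b = c"
proof (rule ccontr)
  have *: False if bc: "b < c" "(a, b) \<in> S" "(a, c) \<in> S" for b c
  proof -
    let ?m = "max (- b) c"
    have "sug_imp a a = \<bar>a\<bar>" "sug_imp b c = ?m" "sug_imp c b = - ?m"
      using bc(1) by (auto simp: sug_imp_def)
    then have "(\<bar>a\<bar>, ?m) \<in> S" "(\<bar>a\<bar>, - ?m) \<in> S"
      using pair_algD(4)[OF S bc(2,3)] pair_algD(4)[OF S bc(3,2)] by auto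
    then have "(a, ?m) \<in> S \<and> (a, - ?m) \<in> S"
      using pair_algD(1)[OF S, of "- a" ?m] pair_algD(1)[OF S, of "- a" "- ?m"]
      by (cases "a \<ge> 0") auto
    then show False using a by (auto simp: split_dom_def)
  qed
  assume "b \<noteq> c"
  then show False using *[of b c] *[of c b] assms by linarith
qed

text \<open>This makes collapsing the split elements to 0 monotone. By \<open>key\<close>, any
  \<open>B \<ge> \<bar>c\<bar>\<close> paired with both \<open>\<bar>a\<bar>\<close> and
  \<open>- \<bar>a\<bar>\<close> provides \<open>a'\<close> with the partners \<open>B\<close> and
  \<open>- B\<close>, through a join and a meet.\<close>

lemma split_dom_convex:
  assumes S: "pair_alg S" and "a \<in> split_dom S" and a': "(a', c) \<in> S" "\<bar>a'\<bar> \<le> \<bar>a\<bar>"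
  shows "a' \<in> split_dom S"
proof -
  obtain b where "(a, b) \<in> S" "(a, - b) \<in> S" using assms by (auto simp: split_dom_def)
  note s = split_signs[OF S this]
  have key: "a' \<in> split_dom S" if ab: "\<bar>c\<bar> \<le> B" "(\<bar>a\<bar>, B) \<in> S" "(- \<bar>a\<bar>, B) \<in> S" for B
  proof -
    have "(\<bar>a\<bar>, - B) \<in> S" "(- \<bar>a\<bar>, - B) \<in> S"
      using pair_algD(1)[OF S ab(2)] pair_algD(1)[OF S ab(3)] by auto
    then have "(max a' (- \<bar>a\<bar>), max c B) \<in> S" "(min a' \<bar>a\<bar>, min c (- B)) \<in> S"
      using pair_algD[OF S a'(1)] ab by blast+
    moreover have "max a' (- \<bar>a\<bar>) = a'" "max c B = B" "min a' \<bar>a\<bar> = a'" "min c (- B) = - B"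
      using a' ab by linarith+
    ultimately show ?thesis by (auto simp: split_dom_def)
  qed
  consider "\<bar>c\<bar> \<le> \<bar>b\<bar>" | "\<bar>a'\<bar> = \<bar>a\<bar>" | "\<bar>c\<bar> > \<bar>b\<bar>" "\<bar>a'\<bar> < \<bar>a\<bar>" using a' by linarith
  then show ?thesis
  proof cases
    case 1
    then show ?thesis using key[of "\<bar>b\<bar>"] s by blast
  next
    case 2
    then have "a' = \<bar>a\<bar> \<or> a' = - \<bar>a\<bar>" by linarith
    then show ?thesis using s by (auto simp: split_dom_def)
  next
    case 3
    \<comment> \<open>Implication into a pair \<open>(d, \<bar>c\<bar>)\<close> raises the second
      coordinate from \<open>\<bar>b\<bar>\<close> to \<open>\<bar>c\<bar>\<close>. Since
      \<open>\<bar>d\<bar> < \<bar>a\<bar>\<close>, it only changes the sign of the first, so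
      \<open>key\<close> applies with \<open>\<bar>c\<bar>\<close>.\<close>
    have "(- \<bar>a'\<bar>, \<bar>c\<bar>) \<in> S \<or> (\<bar>a'\<bar>, \<bar>c\<bar>) \<in> S"
      using a'(1) pair_algD(1)[OF S a'(1)] by (cases "a' \<ge> 0"; cases "c \<ge> 0"; force)
    then obtain d where d: "(d, \<bar>c\<bar>) \<in> S" "\<bar>d\<bar> < \<bar>a\<bar>" using 3 by force
    have "sug_imp \<bar>a\<bar> d = - \<bar>a\<bar>" "sug_imp (- \<bar>a\<bar>) d = \<bar>a\<bar>" "sug_imp \<bar>b\<bar> \<bar>c\<bar> = \<bar>c\<bar>"
      using 3 d by (auto simp: sug_imp_def)
    then have "(\<bar>a\<bar>, \<bar>c\<bar>) \<in> S" "(- \<bar>a\<bar>, \<bar>c\<bar>) \<in> S"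
      using pair_algD(4)[OF S s(1) d(1)] pair_algD(4)[OF S s(2) d(1)] by auto
    then show ?thesis using key by blast
  qed
qed

text \<open>Both maps collapse split elements to 0; elsewhere \<open>h\<close> is the identity and
  \<open>k\<close> picks the unique partner. \<open>S\<close> is a full rectangle on the split parts
  and a bijection off them, so equal images characterize membership.\<close>

theorem pair_alg_pullback:
  assumes S: "pair_alg S" and sub: "S \<subseteq> {- int n..int n} \<times> {- int n..int n}"
  obtains h k where "odd_hom n (fst ` S) h" "odd_hom n (snd ` S) k"
    "\<And>a b. a \<in> fst ` S \<Longrightarrow> b \<in> snd ` S \<Longrightarrow> (a, b) \<in> S \<longleftrightarrow> h a = k b"
proof -
  note S' = pair_alg_converse[OF S]
  define h where "h a = (if a \<in> split_dom S then 0 else a)" for a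
  define k where "k b = (if b \<in> split_dom (S\<inverse>) then 0 else (THE a. (a, b) \<in> S))" for b
  \<comment> \<open>If 0 occurs as a first coordinate it is split; hence among first coordinates
    \<open>h\<close> takes the value 0 only at split elements.\<close>
  have zero: "0 \<in> split_dom S" if "(0, b) \<in> S" for b
    using that pair_algD(1)[OF S that] by (auto simp: split_dom_def)
  have iff: "a \<in> split_dom S \<longleftrightarrow> b \<in> split_dom (S\<inverse>)" if "(a, b) \<in> S" for a b
    using split_dom_converse[OF S that] split_dom_converse[OF S', of b a] that by auto
  have k: "k b = a" if "(a, b) \<in> S" "a \<notin> split_dom S" for a b
  proof -
    have "b \<notin> split_dom (S\<inverse>)" using iff that by blast
    then show ?thesis
      unfolding k_def using that nonsplit_unique[OF S', of b] by auto
  qed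
  have kh: "k b = h a" if "(a, b) \<in> S" for a b
    using k[OF that] iff[OF that] by (auto simp: h_def k_def)
  have neg: "- a \<in> split_dom S \<longleftrightarrow> a \<in> split_dom S" for a
    using pair_algD(1)[OF S] by (force simp: split_dom_def)
  have h: "odd_hom n (fst ` S) h"
    unfolding odd_hom_def
  proof (intro conjI ballI impI)
    fix a assume a: "a \<in> fst ` S"
    then show "\<bar>h a\<bar> \<le> int n" using sub by (force simp: h_def)
    show "h (- a) = - h a" by (simp add: h_def neg)
  next
    fix a b assume ab: "a \<in> fst ` S" "b \<in> fst ` S" "a < b"
    then have "b \<in> split_dom S" if "a \<in> split_dom S" "b \<le> 0"
      using that split_dom_convex[OF S that(1)] by force
    moreover have "a \<in> split_dom S" if "b \<in> split_dom S" "a \<ge> 0"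
      using that split_dom_convex[OF S that(1)] ab by force
    ultimately show "h a < h b \<or> h a = 0 \<and> h b = 0"
      using ab(3) by (cases "b \<le> 0"; cases "a \<ge> 0"; auto simp: h_def)
  qed
  have "odd_hom n (snd ` S) k"
    unfolding odd_hom_def
  proof (intro conjI ballI impI)
    fix b assume "b \<in> snd ` S"
    then obtain a where a: "(a, b) \<in> S" by auto
    show "\<bar>k b\<bar> \<le> int n" using h a kh[OF a] by (force simp: odd_hom_def)
    show "k (- b) = - k b" using kh[OF a] kh[OF pair_algD(1)[OF S a]] by (simp add: h_def neg)
  next
    fix b b' assume "b \<in> snd ` S" "b' \<in> snd ` S" and lt: "b < b'"
    then obtain a a' where a: "(a, b) \<in> S" "(a', b') \<in> S" by auto
    then have aS: "a \<in> fst ` S" "a' \<in> fst ` S" by force+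
    consider "a < a'" | "a = a'" | "a' < a" by linarith
    then show "k b < k b' \<or> k b = 0 \<and> k b' = 0"
    proof cases
      case 1
      then show ?thesis using h aS kh[OF a(1)] kh[OF a(2)] by (auto simp: odd_hom_def)
    next
      case 2
      then have "a \<in> split_dom S" using nonsplit_unique[OF S, of a b b'] a lt by auto
      then show ?thesis using 2 kh[OF a(1)] kh[OF a(2)] by (simp add: h_def)
    next
      case 3
      \<comment> \<open>The two coordinates are ordered oppositely, so a meet pairs
        \<open>a'\<close> with \<open>b\<close>. Then \<open>a\<close> and \<open>a'\<close> have
        the same image, which must be 0.\<close>
      then have "(a', b) \<in> S" using pair_algD(2)[OF S a] lt by (simp add: min_def)
      then have "h a' = h a" using kh[of a b] kh[of a' b] a by simp
      then show ?thesis using 3 h aS kh[OF a(1)] kh[OF a(2)] by (force simp: odd_hom_def)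
    qed
  qed
  moreover have "(a, b) \<in> S \<longleftrightarrow> h a = k b" if ab: "a \<in> fst ` S" "b \<in> snd ` S" for a b
  proof
    assume "(a, b) \<in> S"
    then show "h a = k b" using kh by simp
  next
    assume eq: "h a = k b"
    obtain a' where a': "(a', b) \<in> S" using ab by auto
    have "h a' = h a" using kh[OF a'] eq by simp
    then consider "a \<in> split_dom S" "a' \<in> split_dom S" | "a = a'"
      using zero a' ab by (fastforce simp: h_def split: if_splits)
    then show "(a, b) \<in> S"
    proof cases
      case 1
      then show ?thesis using iff[OF a'] split_dom_rect[OF S] by blast
    qed (use a' in simp)
  qed
  ultimately show ?thesis using that h by blast
qed

section \<open>The Sugihara operations and the alter ego\<close>

lemma universe_Z_odd [simp]: "universe (Z_odd n) = {- int n..int n}"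
  and op_Z_odd [simp]: "op (Z_odd n) = sug_interp"
  by (simp_all add: Z_odd_def subalg_def Z_alg_def)

lemma universe_subalg [simp]: "universe (subalg A S) = S"
  and op_subalg [simp]: "op (subalg A S) = op A"
  by (simp_all add: subalg_def)

lemma universe_power_alg [simp]: "universe (power_alg M I) = (I \<rightarrow>\<^sub>E universe M)"
  and op_power_alg [simp]: "op (power_alg M I) s xs = (\<lambda>i\<in>I. op M s (map (\<lambda>x. x i) xs))"
  by (simp_all add: power_alg_def)

lemma topo_Z_ego [simp]: "topo (Z_ego n) = discrete_topology {- int n..int n}"
  by (simp add: Z_ego_def substr_def)

lemma pop_Z_ego: "pop (Z_ego n) s xs = (if set xs \<subseteq> {- int n..int n} then ego_interp s xs else None)"
  by (simp add: Z_ego_def substr_def)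

lemma sug_args_cases:
  assumes "length xs = sug_arity s"
  obtains a where "s = Neg" "xs = [a]" | a b where "s \<noteq> Neg" "xs = [a, b]"
  using assms by (cases s) (auto simp: numeral_2_eq_2 length_Suc_conv)

lemma is_algebra_sug_iff:
  "is_algebra sug_arity A \<longleftrightarrow> universe A \<noteq> {} \<and> (\<forall>a\<in>universe A. op A Neg [a] \<in> universe A) \<and>
     (\<forall>s a b. s \<noteq> Neg \<and> a \<in> universe A \<and> b \<in> universe A \<longrightarrow> op A s [a, b] \<in> universe A)"
  (is "?L \<longleftrightarrow> ?R")
proof
  assume L: ?L
  show ?R
  proof (intro conjI ballI allI impI)
    show "universe A \<noteq> {}" using L by (simp add: is_algebra_def)
    show "op A Neg [a] \<in> universe A" if "a \<in> universe A" for a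
      using L that unfolding is_algebra_def by (metis empty_set empty_subsetI insert_subset length_Cons
          list.simps(15) list.size(3) One_nat_def sug_arity.simps(4))
    show "op A s [a, b] \<in> universe A" if "s \<noteq> Neg \<and> a \<in> universe A \<and> b \<in> universe A" for s a b
    proof -
      have "length [a, b] = sug_arity s" using that by (cases s) auto
      then show ?thesis using L that unfolding is_algebra_def by (metis empty_set empty_subsetI insert_subset list.simps(15))
    qed
  qed
next
  assume R: ?R
  then show ?L unfolding is_algebra_def by (auto elim!: sug_args_cases)
qed

lemma homs_sug_iff:
  "h \<in> homs sug_arity A B \<longleftrightarrow> h \<in> universe A \<rightarrow>\<^sub>E universe B \<and>
     (\<forall>a\<in>universe A. h (op A Neg [a]) = op B Neg [h a]) \<and>
     (\<forall>s a b. s \<noteq> Neg \<and> a \<in> universe A \<and> b \<in> universe A \<longrightarrow> h (op A s [a, b]) = op B s [h a, h b])"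
  (is "?L \<longleftrightarrow> ?R")
proof
  assume L: ?L
  have *: "h (op A s xs) = op B s (map h xs)" if "length xs = sug_arity s" "set xs \<subseteq> universe A" for s xs
    using L that by (auto simp: homs_def)
  show ?R
  proof (intro conjI ballI allI impI)
    show "h \<in> universe A \<rightarrow>\<^sub>E universe B" using L by (simp add: homs_def)
    show "h (op A Neg [a]) = op B Neg [h a]" if "a \<in> universe A" for a
      using *[of "[a]" Neg] that by simp
    show "h (op A s [a, b]) = op B s [h a, h b]" if "s \<noteq> Neg \<and> a \<in> universe A \<and> b \<in> universe A" for s a b
      using *[of "[a, b]" s] that by (cases s) auto
  qed
next
  assume R: ?R
  then show ?L unfolding homs_def by (auto elim!: sug_args_cases)
qed

text \<open>Each operation returns one of its arguments or the negative of one.\<close>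

lemma sug_interp_closed:
  assumes "length xs = sug_arity s" "set xs \<subseteq> B" "\<And>b. b \<in> B \<Longrightarrow> - b \<in> B"
  shows "sug_interp s xs \<in> B"
  using assms(1)
proof (cases rule: sug_args_cases)
  case (2 a b)
  then show ?thesis using assms by (cases s) (auto simp: sug_imp_def min_def max_def)
qed (use assms in auto)

lemma ego_sig_dom: "s \<in> dom (ego_sig n) \<longleftrightarrow> s = Zero \<or> s = G \<or> (\<exists>i\<le>n. s = F i)"
  by (cases s) (auto simp: dom_def)

lemma ego_interp_Some: "ego_interp s xs = Some y \<Longrightarrow> s = Zero \<and> xs = [] \<or> s \<noteq> Zero \<and> (\<exists>x. xs = [x])"
  by (cases "(s, xs)" rule: ego_interp.cases) auto

lemma f_part_Some:
  "f_part i a = Some b \<longleftrightarrow> a \<noteq> int i \<and> a \<noteq> - int i \<and>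
     b = (if int i > 1 \<and> a = int i - 1 then int i else if int i > 1 \<and> a = - (int i - 1) then - int i else a)"
  unfolding f_part_def by auto

text \<open>On its domain \<open>F i\<close> is odd and strictly increasing, so it preserves and
  reflects the comparisons that decide each operation.\<close>

lemma f_part_sug_interp:
  assumes "f_part i a = Some a'" "f_part i b = Some b'"
  shows "f_part i (- a) = Some (- a')" "f_part i (min a b) = Some (min a' b')"
    "f_part i (max a b) = Some (max a' b')" "f_part i (sug_imp a b) = Some (sug_imp a' b')"
proof -
  have *: "f_part i (- c) = Some (- c')" if "f_part i c = Some c'" for c c'
    using that unfolding f_part_Some by (simp split: if_splits; linarith)
  have mono: "x \<le> y \<longleftrightarrow> x' \<le> y'" if "f_part i x = Some x'" "f_part i y = Some y'" for x x' y y'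
    using that unfolding f_part_Some by (smt (verit) of_nat_0_le_iff)
  have m: "a \<le> b \<longleftrightarrow> a' \<le> b'" "- a \<le> b \<longleftrightarrow> - a' \<le> b'"
    using mono[OF assms] mono[OF *[OF assms(1)] assms(2)] by auto
  show "f_part i (- a) = Some (- a')" using * assms by blast
  show "f_part i (min a b) = Some (min a' b')" "f_part i (max a b) = Some (max a' b')"
    using m assms by (simp_all add: min_def max_def)
  show "f_part i (sug_imp a b) = Some (sug_imp a' b')"
    using m assms *[OF assms(1)] by (simp add: min_def max_def sug_imp_def)
qed

text \<open>\<open>G\<close> is odd and monotone. It loses a strict comparison only when both values
  become 0, where implication returns 0 as well.\<close>

lemma g_map_sug_interp:
  "g_map (- a) = - g_map a" "g_map (min a b) = min (g_map a) (g_map b)"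
  "g_map (max a b) = max (g_map a) (g_map b)" "g_map (sug_imp a b) = sug_imp (g_map a) (g_map b)"
proof -
  have mono: "g_map x \<le> g_map y" if "x \<le> y" for x y using that by (simp add: g_map_def)
  show neg: "g_map (- a) = - g_map a" for a by (simp add: g_map_def)
  show mn: "g_map (min a b) = min (g_map a) (g_map b)" and mx: "g_map (max a b) = max (g_map a) (g_map b)" for a b
    using mono[of a b] mono[of b a] by (auto simp: min_def max_def)
  have "g_map a = 0 \<and> g_map b = 0" if "b < a" "g_map a \<le> g_map b"
    using that unfolding g_map_def by (simp split: if_splits)
  then show "g_map (sug_imp a b) = sug_imp (g_map a) (g_map b)"
    using mono[of a b] by (auto simp: sug_imp_def mn mx neg)
qed

text \<open>That the left side is defined makes the domain of a unary symbol closed under the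
  operations; its value makes the symbol a homomorphism there.\<close>

lemma ego_interp_sug_interp:
  assumes "length xs = sug_arity s" and p: "p \<noteq> Zero"
    and "\<And>x. x \<in> set xs \<Longrightarrow> ego_interp p [x] = Some (k x)"
  shows "ego_interp p [sug_interp s xs] = Some (sug_interp s (map k xs))"
  using assms(1)
proof (cases rule: sug_args_cases)
  case (1 a)
  then show ?thesis using assms f_part_sug_interp(1)[of _ a "k a"] g_map_sug_interp(1)
    by (cases p) auto
next
  case (2 a b)
  then have k: "ego_interp p [a] = Some (k a)" "ego_interp p [b] = Some (k b)"
    using assms(3) by auto
  show ?thesis
  proof (cases p)
    case (F i)
    then show ?thesis using f_part_sug_interp[of i a "k a" b "k b"] k 2 by (cases s) simp_all
  next
    case G
    then show ?thesis using g_map_sug_interp(2-)[of a b] k 2 by (cases s) simp_all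
  qed (use p in simp)
qed

lemma sug_interp_zero: "length xs = sug_arity s \<Longrightarrow> set xs \<subseteq> {0} \<Longrightarrow> sug_interp s xs = 0"
  using sug_interp_closed[of xs s "{0}"] by auto

lemma ego_interp_range:
  assumes "ego_interp s xs = Some y" "set xs \<subseteq> {- int n..int n}" "s \<in> dom (ego_sig n)"
  shows "y \<in> {- int n..int n}"
  using ego_interp_Some[OF assms(1)] assms
  by (auto simp: ego_sig_dom f_part_Some g_map_def split: if_splits)

lemma is_tstruct_Z_ego: "is_tstruct (ego_sig n) (Z_ego n)"
  unfolding is_tstruct_def
proof (intro allI impI)
  fix s k xs y assume *: "ego_sig n s = Some k \<and> pop (Z_ego n) s xs = Some y"
  then have e: "ego_interp s xs = Some y" "set xs \<subseteq> {- int n..int n}" "s \<in> dom (ego_sig n)"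
    by (auto simp: pop_Z_ego split: if_splits)
  have "length xs = k" using ego_interp_Some[OF e(1)] * by (cases s) (auto split: if_splits)
  then show "length xs = k \<and> set xs \<subseteq> points (Z_ego n) \<and> y \<in> points (Z_ego n)"
    using e ego_interp_range by simp
qed

lemma is_algebra_Z_odd: "is_algebra sug_arity (Z_odd n)"
  unfolding is_algebra_def using sug_interp_closed[of _ _ "{- int n..int n}"] by auto

section \<open>Compactness and discrete-valued maps\<close>

text \<open>Read \<open>R a z\<close> as: \<open>a\<close> is good at \<open>z\<close>. By
  compactness finitely many members of \<open>Q\<close> serve all points, and the last assumption
  merges them into one. A point in the space keeps the finite family nonempty.\<close>

lemma compact_space_glue:
  assumes "compact_space T" and ne: "topspace T \<noteq> {}"
    and "\<And>a. a \<in> Q \<Longrightarrow> openin T {z \<in> topspace T. R a z}"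
    and "\<And>z. z \<in> topspace T \<Longrightarrow> \<exists>a\<in>Q. R a z"
    and join: "\<And>a b. a \<in> Q \<Longrightarrow> b \<in> Q \<Longrightarrow> \<exists>c\<in>Q. \<forall>z\<in>topspace T. R a z \<or> R b z \<longrightarrow> R c z"
  shows "\<exists>a\<in>Q. \<forall>z\<in>topspace T. R a z"
proof -
  let ?U = "\<lambda>a. {z \<in> topspace T. R a z}"
  have "\<exists>\<F>. finite \<F> \<and> \<F> \<subseteq> ?U ` Q \<and> topspace T \<subseteq> \<Union>\<F>"
    using assms(1)[unfolded compact_space_alt, rule_format, of "?U ` Q"] assms(3,4) by fastforce
  then obtain \<F> where \<F>: "finite \<F>" "\<F> \<subseteq> ?U ` Q" "topspace T \<subseteq> \<Union>\<F>" by blast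
  then obtain Q' where "finite Q'" "Q' \<subseteq> Q" "\<F> = ?U ` Q'"
    using finite_subset_image[OF \<F>(1,2)] by blast
  with \<F>(3) have Q': "finite Q'" "Q' \<subseteq> Q" "topspace T \<subseteq> \<Union>(?U ` Q')" by blast+
  have "Q' \<noteq> {}" using Q' ne by auto
  with Q'(1) have "Q' \<subseteq> Q \<Longrightarrow> \<exists>c\<in>Q. \<forall>a\<in>Q'. \<forall>z\<in>topspace T. R a z \<longrightarrow> R c z"
  proof (induction rule: finite_ne_induct)
    case (insert a F)
    then obtain c where "c \<in> Q" "\<forall>a\<in>F. \<forall>z\<in>topspace T. R a z \<longrightarrow> R c z" by auto
    then show ?case using join[of a c] insert.prems by (metis insert_iff insert_subset)
  qed auto
  then show ?thesis using Q' by blast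
qed

lemma openin_discrete_pair:
  assumes f: "continuous_map T (discrete_topology U) f" and g: "continuous_map T (discrete_topology V) g"
  shows "openin T {z \<in> topspace T. P (f z) (g z)}"
proof -
  have "{z \<in> topspace T. P (f z) (g z)} =
     (\<Union>(a, b)\<in>{(a, b). a \<in> U \<and> b \<in> V \<and> P a b}. {z \<in> topspace T. f z \<in> {a}} \<inter> {z \<in> topspace T. g z \<in> {b}})"
    using continuous_map_funspace[OF f] continuous_map_funspace[OF g] by auto
  moreover have "openin T {z \<in> topspace T. f z \<in> {a}}" if "a \<in> U" for a
    using openin_continuous_map_preimage[OF f, of "{a}"] that by simp
  moreover have "openin T {z \<in> topspace T. g z \<in> {a}}" if "a \<in> V" for a
    using openin_continuous_map_preimage[OF g, of "{a}"] that by simp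
  ultimately show ?thesis by (auto intro!: openin_Union openin_Int)
qed

section \<open>The alter ego conditions\<close>

lemma is_alter_ego_Z_ego:
  assumes "n \<ge> 1"
  shows "is_alter_ego sug_arity (ego_sig n) (Z_odd n) (Z_ego n)"
proof -
  let ?M = "{- int n..int n}"
  define D where "D s k = {t \<in> {..<k} \<rightarrow>\<^sub>E ?M. pop (Z_ego n) s (map t [0..<k]) \<noteq> None}" for s and k :: nat
  have "is_subuniverse sug_arity (D s k) (power_alg (Z_odd n) {..<k}) \<and>
     (\<lambda>t\<in>D s k. the (pop (Z_ego n) s (map t [0..<k]))) \<in> homs sug_arity (subalg (power_alg (Z_odd n) {..<k}) (D s k)) (Z_odd n)"
    if sk: "ego_sig n s = Some k" for s k
  proof (cases "s = Zero")
    case True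
    then have k: "k = 0" using sk by simp
    \<comment> \<open>The power over the empty index set has exactly this one tuple.\<close>
    have D: "D s k = {\<lambda>_. undefined}" unfolding D_def k True by (auto simp: pop_Z_ego)
    have zero: "the (pop (Z_ego n) s (map t [0..<k])) = 0" for t unfolding k True by (simp add: pop_Z_ego)
    have hom: "(\<lambda>t\<in>{\<lambda>_::nat. undefined}. 0) \<in> homs sug_arity (subalg (power_alg (Z_odd n) {..<0}) {\<lambda>_. undefined}) (Z_odd n)"
      (is "?h \<in> _")
      unfolding homs_def
    proof (intro CollectI conjI allI impI)
      fix r and xs :: "(nat \<Rightarrow> int) list"
      assume xs: "length xs = sug_arity r \<and> set xs \<subseteq> universe (subalg (power_alg (Z_odd n) {..<0}) {\<lambda>_. undefined})"
      then have "set (map ?h xs) \<subseteq> {0}" by auto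
      then have "sug_interp r (map ?h xs) = 0" using xs by (intro sug_interp_zero) auto
      then show "?h (op (subalg (power_alg (Z_odd n) {..<0}) {\<lambda>_. undefined}) r xs) = op (Z_odd n) r (map ?h xs)"
        by (simp add: restrict_def)
    qed auto
    show ?thesis unfolding D zero using hom
      by (auto simp: is_subuniverse_def is_algebra_def k)
  next
    case False
    then have k: "k = 1" and s: "s \<in> dom (ego_sig n)" using sk by (cases s; auto split: if_splits)+
    define q where "q x = the (ego_interp s [x])" for x
    have D: "t \<in> D s k \<longleftrightarrow> t \<in> {..<k} \<rightarrow>\<^sub>E ?M \<and> ego_interp s [t 0] \<noteq> None" for t
    proof -
      have m: "map u [0..<k] = [u 0]" for u :: "nat \<Rightarrow> int" using k by simp
      have "set [t 0] \<subseteq> ?M" if "t \<in> {..<k} \<rightarrow>\<^sub>E ?M"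
        using PiE_mem[OF that, of 0] k by simp
      then show ?thesis unfolding D_def m pop_Z_ego by (cases "t \<in> {..<k} \<rightarrow>\<^sub>E ?M") simp_all
    qed
    have D0: "t 0 \<in> ?M" if "t \<in> D s k" for t
      using PiE_mem[of t "{..<k}" "\<lambda>_. ?M" 0] that k D by simp
    have Dsub: "D s k \<subseteq> {..<k} \<rightarrow>\<^sub>E ?M" using D by blast
    have val: "the (pop (Z_ego n) s (map t [0..<k])) = q (t 0)" if "t \<in> D s k" for t
    proof -
      have m: "map u [0..<k] = [u 0]" for u :: "nat \<Rightarrow> int" using k by simp
      have "set [t 0] \<subseteq> ?M" using D0[OF that] by simp
      then show ?thesis unfolding m pop_Z_ego by (simp add: q_def)
    qed
    have q: "ego_interp s [x] = Some (q x)" if "ego_interp s [x] \<noteq> None" for x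
      using that by (auto simp: q_def)
    have step: "(\<lambda>i\<in>{..<k}. sug_interp r (map (\<lambda>x. x i) xs)) \<in> D s k \<and>
        q (sug_interp r (map (\<lambda>x. x 0) xs)) = sug_interp r (map (\<lambda>t. q (t 0)) xs)"
      if xs: "length xs = sug_arity r" "set xs \<subseteq> D s k" for r xs
    proof -
      let ?ys = "map (\<lambda>x. x 0) xs"
      have "ego_interp s [sug_interp r ?ys] = Some (sug_interp r (map q ?ys))"
      proof (rule ego_interp_sug_interp[OF _ False])
        show "ego_interp s [x] = Some (q x)" if "x \<in> set ?ys" for x
          using that xs D q by auto
      qed (use xs in simp)
      moreover have "sug_interp r ?ys \<in> ?M"
      proof (rule sug_interp_closed)
        show "set ?ys \<subseteq> ?M" using xs(2) D0 by auto
      qed (use xs in auto)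
      ultimately show ?thesis unfolding D using k by (simp add: q_def comp_def)
    qed
    \<comment> \<open>Every domain contains 0 except that of \<open>F 0\<close>, which contains 1;
      for 1 to be in the universe, \<open>n\<close> must be at least 1.\<close>
    have "(\<lambda>i\<in>{..<k}. if s = F 0 then 1 else 0) \<in> D s k"
      using assms False k unfolding D by (cases s) (simp_all add: f_part_def PiE_iff)
    moreover have "q (t 0) \<in> ?M" if "t \<in> D s k" for t
    proof (rule ego_interp_range[OF q _ s])
      show "ego_interp s [t 0] \<noteq> None" "set [t 0] \<subseteq> ?M" using that D0[OF that] D by simp_all
    qed
    moreover have "(\<lambda>t\<in>D s k. the (pop (Z_ego n) s (map t [0..<k]))) = (\<lambda>t\<in>D s k. q (t 0))"
      using val by (intro restrict_ext) auto
    moreover have "map (\<lambda>t\<in>D s k. q (t 0)) xs = map (\<lambda>t. q (t 0)) xs" if "set xs \<subseteq> D s k" for xs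
      using that by auto
    moreover have "(\<lambda>i\<in>{..<k}. c i) 0 = c 0" for c :: "nat \<Rightarrow> int" using k by simp
    ultimately have *: "D s k \<noteq> {}" "\<And>t. t \<in> D s k \<Longrightarrow> q (t 0) \<in> ?M"
      "(\<lambda>t\<in>D s k. the (pop (Z_ego n) s (map t [0..<k]))) = (\<lambda>t\<in>D s k. q (t 0))"
      "\<And>xs. set xs \<subseteq> D s k \<Longrightarrow> map (\<lambda>t\<in>D s k. q (t 0)) xs = map (\<lambda>t. q (t 0)) xs"
      by blast+
    have "is_subuniverse sug_arity (D s k) (power_alg (Z_odd n) {..<k})"
      unfolding is_subuniverse_def is_algebra_def using step *(1) Dsub by simp
    moreover have "(\<lambda>t\<in>D s k. q (t 0)) \<in> homs sug_arity (subalg (power_alg (Z_odd n) {..<k}) (D s k)) (Z_odd n)"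
      unfolding homs_def
    proof (intro CollectI conjI allI impI)
      show "(\<lambda>t\<in>D s k. q (t 0)) \<in> universe (subalg (power_alg (Z_odd n) {..<k}) (D s k)) \<rightarrow>\<^sub>E universe (Z_odd n)"
        using *(2) by auto
      fix r and xs :: "(nat \<Rightarrow> int) list"
      assume xs: "length xs = sug_arity r \<and> set xs \<subseteq> universe (subalg (power_alg (Z_odd n) {..<k}) (D s k))"
      have "(\<lambda>i\<in>{..<k}. sug_interp r (map (\<lambda>x. x i) xs)) 0 = sug_interp r (map (\<lambda>x. x 0) xs)"
        using k by simp
      then show "(\<lambda>t\<in>D s k. q (t 0)) (op (subalg (power_alg (Z_odd n) {..<k}) (D s k)) r xs) =
          op (Z_odd n) r (map (\<lambda>t\<in>D s k. q (t 0)) xs)"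
        using step[of xs r] xs *(4)[of xs] by (simp del: map_eq_conv)
    qed
    ultimately show ?thesis unfolding *(3) by blast
  qed
  then show ?thesis
    unfolding is_alter_ego_def Let_def D_def
    using is_algebra_Z_odd is_tstruct_Z_ego by simp
qed

section \<open>Morphisms and homomorphisms on a substructure of a dual space\<close>

lemma morphs_Z_egoD:
  assumes "\<alpha> \<in> morphs (ego_sig n) X (Z_ego n)"
  shows "\<alpha> \<in> points X \<rightarrow>\<^sub>E {- int n..int n}"
    and "continuous_map (topo X) (discrete_topology {- int n..int n}) \<alpha>"
    and "s \<in> dom (ego_sig n) \<Longrightarrow> set xs \<subseteq> points X \<Longrightarrow> pop X s xs = Some y \<Longrightarrow>
      ego_interp s (map \<alpha> xs) = Some (\<alpha> y)"
proof -
  show "\<alpha> \<in> points X \<rightarrow>\<^sub>E {- int n..int n}" "continuous_map (topo X) (discrete_topology {- int n..int n}) \<alpha>"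
    using assms by (auto simp: morphs_def)
  assume "s \<in> dom (ego_sig n)" "set xs \<subseteq> points X" "pop X s xs = Some y"
  then have "pop (Z_ego n) s (map \<alpha> xs) = Some (\<alpha> y)" using assms by (auto simp: morphs_def)
  then show "ego_interp s (map \<alpha> xs) = Some (\<alpha> y)" by (auto simp: pop_Z_ego split: if_splits)
qed

lemma morphs_Z_egoI:
  assumes "\<alpha> \<in> points X \<rightarrow>\<^sub>E {- int n..int n}"
    and "continuous_map (topo X) (discrete_topology {- int n..int n}) \<alpha>"
    and "\<And>s xs y. s \<in> dom (ego_sig n) \<Longrightarrow> set xs \<subseteq> points X \<Longrightarrow> pop X s xs = Some y \<Longrightarrow>
      ego_interp s (map \<alpha> xs) = Some (\<alpha> y)"
  shows "\<alpha> \<in> morphs (ego_sig n) X (Z_ego n)"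
proof -
  have "pop (Z_ego n) s (map \<alpha> xs) = Some (\<alpha> y)"
    if "s \<in> dom (ego_sig n)" "set xs \<subseteq> points X" "pop X s xs = Some y" for s xs y
  proof -
    have "set (map \<alpha> xs) \<subseteq> {- int n..int n}" using that(2) assms(1) by (auto simp: PiE_iff)
    then show ?thesis using assms(3)[OF that] by (simp add: pop_Z_ego)
  qed
  then show ?thesis using assms(1,2) by (simp add: morphs_def)
qed

text \<open>\<open>X\<close> is identified by \<open>e\<close> with a compact substructure of the dual space of \<open>A\<close>.\<close>

locale dual_subspace =
  fixes n :: nat and X :: "(ego_sym, 'p) tstruct" and A :: "(sug_op, 'a) algebra"
    and e :: "'p \<Rightarrow> 'a \<Rightarrow> int"
  assumes tstruct: "is_tstruct (ego_sig n) X"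
    and alg: "is_algebra sug_arity A"
    and compact: "compact_space (topo X)"
    and nonempty: "points X \<noteq> {}"
    and hom: "x \<in> points X \<Longrightarrow> e x \<in> homs sug_arity A (Z_odd n)"
    and cont: "a \<in> universe A \<Longrightarrow> continuous_map (topo X) (discrete_topology {- int n..int n}) (\<lambda>x. e x a)"
    and pres: "s \<in> dom (ego_sig n) \<Longrightarrow> a \<in> universe A \<Longrightarrow> pop X s [x] = Some y \<Longrightarrow> ego_interp s [e x a] = Some (e y a)"
    and reflect: "s \<in> dom (ego_sig n) \<Longrightarrow> x \<in> points X \<Longrightarrow> (\<And>a. a \<in> universe A \<Longrightarrow> ego_interp s [e x a] \<noteq> None) \<Longrightarrow>
      pop X s [x] \<noteq> None"
    and inj: "inj_on e (points X)"
begin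

lemma closed:
  assumes "a \<in> universe A" "b \<in> universe A"
  shows "op A Meet [a, b] \<in> universe A" "op A Join [a, b] \<in> universe A"
    "op A Imp [a, b] \<in> universe A" "op A Neg [a] \<in> universe A"
  using alg assms by (auto simp: is_algebra_sug_iff)

lemma hom_ops:
  assumes "u \<in> homs sug_arity A (Z_odd n)" and a: "a \<in> universe A" "b \<in> universe A"
  shows "u (op A Meet [a, b]) = min (u a) (u b)" "u (op A Join [a, b]) = max (u a) (u b)"
    "u (op A Imp [a, b]) = sug_imp (u a) (u b)" "u (op A Neg [a]) = - u a"
  using assms by (auto simp: homs_sug_iff)

lemma hom_bound:
  assumes "u \<in> homs sug_arity A (Z_odd n)" "a \<in> universe A"
  shows "u a \<in> {- int n..int n}"
  using assms by (force simp: homs_def)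

lemma hom_ext:
  assumes "u \<in> homs sug_arity A (Z_odd n)" "v \<in> homs sug_arity A (Z_odd n)"
    "\<And>a. a \<in> universe A \<Longrightarrow> u a = v a"
  shows "u = v"
  using assms by (auto simp: homs_def intro: PiE_ext)

lemma pop_points:
  assumes "s \<in> dom (ego_sig n)" "pop X s xs = Some y"
  shows "set xs \<subseteq> points X" "y \<in> points X"
  using tstruct assms unfolding is_tstruct_def by blast+

lemma pres_morph:
  assumes "s \<in> dom (ego_sig n)" "pop X s [x] = Some y" "\<alpha> \<in> morphs (ego_sig n) X (Z_ego n)"
  shows "ego_interp s [\<alpha> x] = Some (\<alpha> y)"
  using morphs_Z_egoD(3)[OF assms(3,1) _ assms(2)] pop_points(1)[OF assms(1,2)] by simp

lemma image_symmetric: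
  assumes "x \<in> points X" "b \<in> e x ` universe A"
  shows "- b \<in> e x ` universe A"
  using assms hom_ops(4)[OF hom[OF assms(1)]] closed(4) by (metis (no_types, lifting) imageE imageI)

text \<open>Otherwise the image of \<open>e x\<close> avoids \<open>\<alpha> x\<close> and its
  negative, so \<open>F i\<close> with \<open>i\<close> the absolute value of
  \<open>\<alpha> x\<close> is defined at \<open>x\<close>. A morphism then forces it to be defined
  at \<open>\<alpha> x\<close>, which it is not. The restricted identities \<open>F 0\<close> and
  \<open>F 1\<close> serve the values 0, 1 and -1.\<close>

lemma morph_in_image:
  assumes x: "x \<in> points X" and \<alpha>: "\<alpha> \<in> morphs (ego_sig n) X (Z_ego n)"
  shows "\<alpha> x \<in> e x ` universe A"
proof (rule ccontr)
  assume no: "\<alpha> x \<notin> e x ` universe A"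
  define i where "i = nat \<bar>\<alpha> x\<bar>"
  have "\<alpha> x \<in> {- int n..int n}" using morphs_Z_egoD(1)[OF \<alpha>] x by auto
  then have "i \<le> n" by (auto simp: i_def)
  then have s: "F i \<in> dom (ego_sig n)" by auto
  have "ego_interp (F i) [e x a] \<noteq> None" if "a \<in> universe A" for a
  proof -
    have "e x a \<in> e x ` universe A" using that by (rule imageI)
    then have "e x a \<noteq> \<alpha> x" "e x a \<noteq> - \<alpha> x"
      using no image_symmetric[OF x, of "e x a"] by (metis, metis minus_minus)
    then show ?thesis by (auto simp: f_part_def i_def)
  qed
  then obtain y where "pop X (F i) [x] = Some y" using reflect[OF s x] by auto
  then have "ego_interp (F i) [\<alpha> x] = Some (\<alpha> y)" using pres_morph[OF s _ \<alpha>] by blast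
  then show False by (auto simp: f_part_def i_def split: if_splits)
qed

text \<open>The composition is followed inside \<open>X\<close>: \<open>reflect\<close> makes each
  step defined at the current point, and every morphism preserves that step.\<close>

lemma generated_transport:
  assumes "generated n B h" and x: "x \<in> points X" and B: "B = e x ` universe A"
  shows "\<exists>y\<in>points X. (\<forall>a\<in>universe A. e y a = h (e x a)) \<and>
    (\<forall>\<alpha>\<in>morphs (ego_sig n) X (Z_ego n). \<alpha> y = h (\<alpha> x))"
  using assms(1)
proof induction
  case gen_id
  then show ?case using x by auto
next
  case (gen_F h i)
  then obtain y where y: "y \<in> points X" "\<And>a. a \<in> universe A \<Longrightarrow> e y a = h (e x a)"
    "\<And>\<alpha>. \<alpha> \<in> morphs (ego_sig n) X (Z_ego n) \<Longrightarrow> \<alpha> y = h (\<alpha> x)" by auto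
  have s: "F i \<in> dom (ego_sig n)" using gen_F.hyps by auto
  have "ego_interp (F i) [e y a] \<noteq> None" if "a \<in> universe A" for a
    using gen_F.hyps(3)[of "e x a"] that y(2) B by auto
  then obtain z where z: "pop X (F i) [y] = Some z" using reflect[OF s y(1)] by auto
  have "z \<in> points X" using pop_points(2)[OF s z] .
  moreover have "e z a = the (f_part i (h (e x a)))" if "a \<in> universe A" for a
    using pres[OF s that z] y(2)[OF that] by simp
  moreover have "\<alpha> z = the (f_part i (h (\<alpha> x)))" if "\<alpha> \<in> morphs (ego_sig n) X (Z_ego n)" for \<alpha>
    using pres_morph[OF s z that] y(3)[OF that] by simp
  ultimately show ?case by blast
next
  case (gen_G h)
  then obtain y where y: "y \<in> points X" "\<And>a. a \<in> universe A \<Longrightarrow> e y a = h (e x a)"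
    "\<And>\<alpha>. \<alpha> \<in> morphs (ego_sig n) X (Z_ego n) \<Longrightarrow> \<alpha> y = h (\<alpha> x)" by auto
  have s: "G \<in> dom (ego_sig n)" by auto
  obtain z where z: "pop X G [y] = Some z" using reflect[OF s y(1)] by auto
  have "z \<in> points X" using pop_points(2)[OF s z] .
  moreover have "e z a = g_map (h (e x a))" if "a \<in> universe A" for a
    using pres[OF s that z] y(2)[OF that] by simp
  moreover have "\<alpha> z = g_map (h (\<alpha> x))" if "\<alpha> \<in> morphs (ego_sig n) X (Z_ego n)" for \<alpha>
    using pres_morph[OF s z that] y(3)[OF that] by simp
  ultimately show ?case by blast
next
  case (gen_cong h h')
  then obtain y where "y \<in> points X" "\<forall>a\<in>universe A. e y a = h (e x a)"
    "\<forall>\<alpha>\<in>morphs (ego_sig n) X (Z_ego n). \<alpha> y = h (\<alpha> x)" by auto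
  \<comment> \<open>\<open>morph_in_image\<close> puts \<open>\<alpha> x\<close> into
    \<open>B\<close>, where \<open>h\<close> and \<open>h'\<close> agree.\<close>
  then show ?case
    using gen_cong.hyps(2) morph_in_image[OF x] B by (intro bexI[of _ y]) auto
qed

lemma hom_transport:
  assumes "odd_hom n (e x ` universe A) h" and x: "x \<in> points X"
  shows "\<exists>y\<in>points X. (\<forall>a\<in>universe A. e y a = h (e x a)) \<and>
    (\<forall>\<alpha>\<in>morphs (ego_sig n) X (Z_ego n). \<alpha> y = h (\<alpha> x))"
proof -
  have "generated n (e x ` universe A) h"
    using hom_bound[OF hom[OF x]] image_symmetric[OF x] assms by (intro odd_hom_generated) auto
  then show ?thesis using generated_transport[OF _ x refl] by blast
qed

text \<open>The pairs of values at \<open>x\<close> and \<open>y\<close> form a subalgebra of the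
  square, hence a pullback along some \<open>h\<close> and \<open>k\<close>. Moving \<open>x\<close>
  by \<open>h\<close> and \<open>y\<close> by \<open>k\<close> leads to the same point of
  \<open>X\<close>, so \<open>\<alpha>\<close> satisfies the pullback equation too.\<close>

lemma two_point_interpolation:
  assumes \<alpha>: "\<alpha> \<in> morphs (ego_sig n) X (Z_ego n)" and x: "x \<in> points X" and y: "y \<in> points X"
  obtains a where "a \<in> universe A" "e x a = \<alpha> x" "e y a = \<alpha> y"
proof -
  define S where "S = (\<lambda>a. (e x a, e y a)) ` universe A"
  have "pair_alg S"
    unfolding pair_alg_def
  proof (intro conjI allI impI; (elim conjE)?)
    fix b c assume "(b, c) \<in> S"
    then obtain a where "a \<in> universe A" "b = e x a" "c = e y a" by (auto simp: S_def)
    then show "(- b, - c) \<in> S"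
      unfolding S_def using closed(4) hom_ops(4)[OF hom] x y
      by (intro image_eqI[of _ _ "op A Neg [a]"]) auto
  next
    fix b c b' c' assume "(b, c) \<in> S" "(b', c') \<in> S"
    then obtain a a' where *: "a \<in> universe A" "b = e x a" "c = e y a"
      "a' \<in> universe A" "b' = e x a'" "c' = e y a'" by (auto simp: S_def)
    note [simp] = hom_ops[OF hom[OF x]] hom_ops[OF hom[OF y]] closed
    show "(min b b', min c c') \<in> S"
      unfolding S_def using * by (intro image_eqI[of _ _ "op A Meet [a, a']"]) auto
    show "(max b b', max c c') \<in> S"
      unfolding S_def using * by (intro image_eqI[of _ _ "op A Join [a, a']"]) auto
    show "(sug_imp b b', sug_imp c c') \<in> S"
      unfolding S_def using * by (intro image_eqI[of _ _ "op A Imp [a, a']"]) auto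
  qed
  moreover have "S \<subseteq> {- int n..int n} \<times> {- int n..int n}"
    using hom_bound[OF hom[OF x]] hom_bound[OF hom[OF y]] by (auto simp: S_def)
  ultimately obtain h k where hk: "odd_hom n (fst ` S) h" "odd_hom n (snd ` S) k"
    "\<And>a b. a \<in> fst ` S \<Longrightarrow> b \<in> snd ` S \<Longrightarrow> (a, b) \<in> S \<longleftrightarrow> h a = k b"
    using pair_alg_pullback by blast
  have fst: "fst ` S = e x ` universe A" and snd: "snd ` S = e y ` universe A"
    by (auto simp: S_def image_image)
  obtain x' where x': "x' \<in> points X" "\<forall>a\<in>universe A. e x' a = h (e x a)" "\<alpha> x' = h (\<alpha> x)"
    using hom_transport[OF hk(1)[unfolded fst] x] \<alpha> by auto
  obtain y' where y': "y' \<in> points X" "\<forall>a\<in>universe A. e y' a = k (e y a)" "\<alpha> y' = k (\<alpha> y)"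
    using hom_transport[OF hk(2)[unfolded snd] y] \<alpha> by auto
  \<comment> \<open>Each pair \<open>(e x a, e y a)\<close> is in \<open>S\<close>, so both points
    are the same homomorphism, and \<open>inj\<close> identifies them.\<close>
  have "e x' a = e y' a" if "a \<in> universe A" for a
    using x'(2) y'(2) hk(3)[of "e x a" "e y a"] that
    unfolding fst snd by (auto simp: S_def)
  then have "e x' = e y'" using hom_ext hom x'(1) y'(1) by blast
  then have "x' = y'" using inj x'(1) y'(1) by (auto dest: inj_onD)
  then have "(\<alpha> x, \<alpha> y) \<in> S"
    using x'(3) y'(3) hk(3) morph_in_image[OF x \<alpha>] morph_in_image[OF y \<alpha>] unfolding fst snd by metis
  then show ?thesis using that by (auto simp: S_def)
qed

section \<open>Morphisms as evaluations, homomorphisms as points\<close>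

text \<open>Fixing \<open>x\<close>, meets of two-point interpolants produce an element that is
  exact at \<open>x\<close> and nowhere above \<open>\<alpha>\<close>. Joins of such elements over
  varying \<open>x\<close> reach \<open>\<alpha>\<close> everywhere.\<close>

theorem morph_is_evaluation:
  assumes \<alpha>: "\<alpha> \<in> morphs (ego_sig n) X (Z_ego n)"
  shows "\<exists>a\<in>universe A. \<forall>x\<in>points X. e x a = \<alpha> x"
proof -
  have op: "openin (topo X) {z \<in> points X. P (e z a) (\<alpha> z)}" if "a \<in> universe A" for a P
    by (rule openin_discrete_pair[OF cont[OF that] morphs_Z_egoD(2)[OF \<alpha>]])
  have below: "\<exists>a\<in>{a \<in> universe A. e x a = \<alpha> x}. \<forall>z\<in>points X. e z a \<le> \<alpha> z" if x: "x \<in> points X" for x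
  proof (rule compact_space_glue[OF compact nonempty])
    show "\<exists>a\<in>{a \<in> universe A. e x a = \<alpha> x}. e z a \<le> \<alpha> z" if "z \<in> points X" for z
      using two_point_interpolation[OF \<alpha> x that] by (metis (mono_tags, lifting) mem_Collect_eq order_refl)
    show "\<exists>c\<in>{a \<in> universe A. e x a = \<alpha> x}. \<forall>z\<in>points X. e z a \<le> \<alpha> z \<or> e z b \<le> \<alpha> z \<longrightarrow> e z c \<le> \<alpha> z"
      if "a \<in> {a \<in> universe A. e x a = \<alpha> x}" "b \<in> {a \<in> universe A. e x a = \<alpha> x}" for a b
      using that x hom_ops(1)[OF hom] closed(1) by (intro bexI[of _ "op A Meet [a, b]"]) auto
  qed (use op in auto)
  have "\<exists>a\<in>{a \<in> universe A. \<forall>z\<in>points X. e z a \<le> \<alpha> z}. \<forall>z\<in>points X. \<alpha> z \<le> e z a"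
  proof (rule compact_space_glue[OF compact nonempty])
    show "\<exists>a\<in>{a \<in> universe A. \<forall>z\<in>points X. e z a \<le> \<alpha> z}. \<alpha> z \<le> e z a" if "z \<in> points X" for z
      using below[OF that] by force
    show "\<exists>c\<in>{a \<in> universe A. \<forall>z\<in>points X. e z a \<le> \<alpha> z}. \<forall>z\<in>points X. \<alpha> z \<le> e z a \<or> \<alpha> z \<le> e z b \<longrightarrow> \<alpha> z \<le> e z c"
      if "a \<in> {a \<in> universe A. \<forall>z\<in>points X. e z a \<le> \<alpha> z}" "b \<in> {a \<in> universe A. \<forall>z\<in>points X. e z a \<le> \<alpha> z}" for a b
      using that hom_ops(2)[OF hom] closed(2) by (intro bexI[of _ "op A Join [a, b]"]) auto
    show "openin (topo X) {z \<in> points X. \<alpha> z \<le> e z a}" if "a \<in> {a \<in> universe A. \<forall>z\<in>points X. e z a \<le> \<alpha> z}" for a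
      using op[of a "\<lambda>b c. c \<le> b"] that by simp
  qed
  then show ?thesis by (auto intro: antisym)
qed

text \<open>If no point has its kernel inside that of \<open>u\<close>, compactness yields an
  element that is nonnegative at all points but negative under \<open>u\<close>, which is
  impossible. So \<open>u\<close> factors through some \<open>e x\<close> by an
  \<open>odd_hom\<close>, and \<open>hom_transport\<close> turns it into a point.\<close>

theorem hom_is_point:
  assumes u: "u \<in> homs sug_arity A (Z_odd n)"
    and sep: "\<And>a b. a \<in> universe A \<Longrightarrow> b \<in> universe A \<Longrightarrow> (\<And>x. x \<in> points X \<Longrightarrow> e x a = e x b) \<Longrightarrow> a = b"
  shows "\<exists>x\<in>points X. e x = u"
proof -
  have "\<exists>x\<in>points X. \<forall>a\<in>universe A. \<forall>b\<in>universe A. e x a = e x b \<longrightarrow> u a = u b"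
  proof (rule ccontr)
    assume no: "\<not> ?thesis"
    have "\<exists>w\<in>{w \<in> universe A. u w < 0}. \<forall>z\<in>points X. e z w \<ge> 0"
    proof (rule compact_space_glue[OF compact nonempty])
      show "\<exists>w\<in>{w \<in> universe A. u w < 0}. e z w \<ge> 0" if z: "z \<in> points X" for z
      proof -
        obtain a b where ab: "a \<in> universe A" "b \<in> universe A" "e z a = e z b" "u a \<noteq> u b"
          using no z by auto
        \<comment> \<open>The equivalence of \<open>a\<close> and \<open>b\<close>: its value is
          \<open>\<bar>p\<bar>\<close> where both have value \<open>p\<close>, and it is negative
          where their values differ.\<close>
        let ?w = "op A Meet [op A Imp [a, b], op A Imp [b, a]]"
        have "e z ?w \<ge> 0" "u ?w < 0" "?w \<in> universe A"
          using ab hom_ops[OF hom[OF z]] hom_ops[OF u] closed by (auto simp: sug_imp_def min_def max_def)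
        then show ?thesis by blast
      qed
      show "\<exists>c\<in>{w \<in> universe A. u w < 0}. \<forall>z\<in>points X. e z a \<ge> 0 \<or> e z b \<ge> 0 \<longrightarrow> e z c \<ge> 0"
        if "a \<in> {w \<in> universe A. u w < 0}" "b \<in> {w \<in> universe A. u w < 0}" for a b
        using that hom_ops(2)[OF hom] hom_ops(2)[OF u] closed(2)
        by (intro bexI[of _ "op A Join [a, b]"]) auto
      show "openin (topo X) {z \<in> points X. e z a \<ge> 0}" if "a \<in> {w \<in> universe A. u w < 0}" for a
        using openin_discrete_pair[OF cont cont, of a a "\<lambda>b c. b \<ge> 0"] that by simp
    qed
    then obtain w where w: "w \<in> universe A" "u w < 0" "\<And>z. z \<in> points X \<Longrightarrow> e z w \<ge> 0" by auto
    \<comment> \<open>Implication of an element with itself has the absolute value as its value, so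
      separation gives this equation, and \<open>u w\<close> cannot be negative.\<close>
    have "op A Imp [w, w] = w"
      using w hom_ops(3)[OF hom] by (intro sep closed) (auto simp: sug_imp_def)
    then have "u w = sug_imp (u w) (u w)" using hom_ops(3)[OF u w(1) w(1)] by simp
    then show False using w(2) by (simp add: sug_imp_def)
  qed
  then obtain x where x: "x \<in> points X"
    and ker: "\<And>a b. a \<in> universe A \<Longrightarrow> b \<in> universe A \<Longrightarrow> e x a = e x b \<Longrightarrow> u a = u b" by blast
  \<comment> \<open>\<open>h\<close> is \<open>u\<close> read through \<open>e x\<close>;
    \<open>ker\<close> makes the choice of preimage immaterial.\<close>
  define h where "h c = u (SOME a. a \<in> universe A \<and> e x a = c)" for c
  have h: "h (e x a) = u a" if "a \<in> universe A" for a
  proof -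
    have "(SOME b. b \<in> universe A \<and> e x b = e x a) \<in> universe A \<and> e x (SOME b. b \<in> universe A \<and> e x b = e x a) = e x a"
      by (rule someI_ex) (use that in auto)
    then show ?thesis unfolding h_def using ker that by blast
  qed
  have "odd_hom n (e x ` universe A) h"
    unfolding odd_hom_def
  proof (intro conjI ballI impI)
    fix b assume "b \<in> e x ` universe A"
    then obtain a where a: "a \<in> universe A" "b = e x a" by auto
    show "\<bar>h b\<bar> \<le> int n" using hom_bound[OF u a(1)] a h by auto
    show "h (- b) = - h b"
      using h[OF closed(4)[OF a(1) a(1)]] h[OF a(1)] hom_ops(4)[OF hom[OF x] a(1) a(1)] hom_ops(4)[OF u a(1) a(1)] a by simp
  next
    fix c d assume "c \<in> e x ` universe A" "d \<in> e x ` universe A" and lt: "c < d"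
    then obtain a b where ab: "a \<in> universe A" "c = e x a" "b \<in> universe A" "d = e x b" by auto
    have "u (op A Meet [a, b]) = u a"
      using ab lt hom_ops(1)[OF hom[OF x]] closed by (intro ker) auto
    then have le: "u a \<le> u b" using hom_ops(1)[OF u] ab by (simp add: min_def split: if_splits)
    \<comment> \<open>For \<open>c < d\<close> the implications in the two orders are negatives of
      each other. Transferred to \<open>u\<close>, this forces 0 if
      \<open>u a = u b\<close>.\<close>
    have "u (op A Imp [a, b]) = u (op A Neg [op A Imp [b, a]])"
      using ab lt hom_ops[OF hom[OF x]] closed by (intro ker) (auto simp: sug_imp_def)
    then have "sug_imp (u a) (u b) = - sug_imp (u b) (u a)" using hom_ops[OF u] ab closed by simp
    then show "h c < h d \<or> h c = 0 \<and> h d = 0"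
      using le ab h by (cases "u a = u b") (auto simp: sug_imp_def)
  qed
  then obtain y where y: "y \<in> points X" "\<forall>a\<in>universe A. e y a = h (e x a)"
    using hom_transport[OF _ x] by blast
  then have "e y = u" using h hom u by (intro hom_ext) auto
  then show ?thesis using y(1) by blast
qed

end

section \<open>Dual spaces and dual algebras\<close>

lemma continuous_map_sug_interp:
  assumes len: "length fs = sug_arity s"
    and fs: "\<And>f. f \<in> set fs \<Longrightarrow> continuous_map T (discrete_topology {- int n..int n}) f"
  shows "continuous_map T (discrete_topology {- int n..int n}) (\<lambda>x. sug_interp s (map (\<lambda>f. f x) fs))"
proof -
  have "sug_interp s (map (\<lambda>f. f x) fs) \<in> {- int n..int n}" if "x \<in> topspace T" for x
  proof (rule sug_interp_closed)
    show "set (map (\<lambda>f. f x) fs) \<subseteq> {- int n..int n}"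
      using continuous_map_funspace[OF fs] that by fastforce
  qed (use len in auto)
  moreover have "openin T {x \<in> topspace T. sug_interp s (map (\<lambda>f. f x) fs) \<in> U}" for U
    using len
  proof (cases rule: sug_args_cases)
    case (1 f)
    then show ?thesis using openin_discrete_pair[OF fs fs, of f f "\<lambda>a b. sug_interp s [a] \<in> U"] by simp
  next
    case (2 f g)
    then show ?thesis using openin_discrete_pair[OF fs fs, of f g "\<lambda>a b. sug_interp s [a, b] \<in> U"] by simp
  qed
  ultimately show ?thesis by (auto simp: continuous_map_def)
qed

text \<open>The alter ego's operations commute with those of the algebra, so pointwise combinations
  of morphisms preserve them.\<close>

lemma is_algebra_dual_alg:
  assumes X: "is_tstruct (ego_sig n) X" and ne: "morphs (ego_sig n) X (Z_ego n) \<noteq> {}"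
  shows "is_algebra sug_arity (dual_alg (ego_sig n) (Z_odd n) (Z_ego n) X)"
proof -
  have "(\<lambda>x\<in>points X. sug_interp r (map (\<lambda>f. f x) fs)) \<in> morphs (ego_sig n) X (Z_ego n)"
    if len: "length fs = sug_arity r" and fs: "set fs \<subseteq> morphs (ego_sig n) X (Z_ego n)" for r fs
  proof (rule morphs_Z_egoI)
    let ?g = "\<lambda>x\<in>points X. sug_interp r (map (\<lambda>f. f x) fs)"
    have c: "continuous_map (topo X) (discrete_topology {- int n..int n}) (\<lambda>x. sug_interp r (map (\<lambda>f. f x) fs))"
      using continuous_map_sug_interp[OF len] fs morphs_Z_egoD(2) by blast
    then show "continuous_map (topo X) (discrete_topology {- int n..int n}) ?g"
      by (rule continuous_map_eq) simp
    show "?g \<in> points X \<rightarrow>\<^sub>E {- int n..int n}"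
      using continuous_map_funspace[OF c] by (auto simp: Pi_iff)
    fix s xs y assume s: "s \<in> dom (ego_sig n)" and xs: "set xs \<subseteq> points X" and y: "pop X s xs = Some y"
    show "ego_interp s (map ?g xs) = Some (?g y)"
    proof -
      have f: "ego_interp s (map f xs) = Some (f y)" if "f \<in> set fs" for f
        using morphs_Z_egoD(3)[OF _ s xs y] that fs by blast
      \<comment> \<open>No Sugihara operation is nullary, so there is a morphism at hand that
        reveals the length of \<open>xs\<close>.\<close>
      obtain f0 where f0: "f0 \<in> set fs" using len by (cases fs; cases r) auto
      have yX: "y \<in> points X"
        using X s y unfolding is_tstruct_def by blast
      show ?thesis
      proof (cases "s = Zero")
        case True
        then have "xs = []" using ego_interp_Some[OF f[OF f0]] by simp
        then have "set (map (\<lambda>f. f y) fs) \<subseteq> {0}" using f True by auto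
        then have "sug_interp r (map (\<lambda>f. f y) fs) = 0" using len by (intro sug_interp_zero) auto
        then show ?thesis using True \<open>xs = []\<close> yX by simp
      next
        case False
        then obtain x where x: "xs = [x]" using ego_interp_Some[OF f[OF f0]] by auto
        define k where "k v = the (ego_interp s [v])" for v
        have k: "ego_interp s [f x] = Some (k (f x))" "k (f x) = f y" if "f \<in> set fs" for f
          using f[OF that] x by (auto simp: k_def)
        have m: "map (\<lambda>f. f y) fs = map k (map (\<lambda>f. f x) fs)" using k(2) by simp
        have "ego_interp s [sug_interp r (map (\<lambda>f. f x) fs)] = Some (sug_interp r (map (\<lambda>f. f y) fs))"
          unfolding m using len k(1) False by (intro ego_interp_sug_interp) auto
        then show ?thesis using x xs yX by simp
      qed
    qed
  qed
  then show ?thesis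
    using ne by (auto simp: is_algebra_def dual_alg_def)
qed


lemma universe_dual_alg [simp]: "universe (dual_alg \<Sigma> M Mt X) = morphs \<Sigma> X Mt"
  and op_dual_alg [simp]: "op (dual_alg \<Sigma> M Mt X) s fs = (\<lambda>x\<in>points X. op M s (map (\<lambda>f. f x) fs))"
  by (simp_all add: dual_alg_def)

lemma homs_Z_odd_subset: "homs sug_arity A (Z_odd n) \<subseteq> universe A \<rightarrow>\<^sub>E {- int n..int n}"
  by (auto simp: homs_def)

lemma topo_dual_space: "topo (dual_space sug_arity (Z_odd n) (Z_ego n) A) =
    subtopology (product_topology (\<lambda>_. discrete_topology {- int n..int n}) (universe A)) (homs sug_arity A (Z_odd n))"
  by (simp add: dual_space_def substr_def power_struct_def)

lemma points_dual_space [simp]: "points (dual_space sug_arity (Z_odd n) (Z_ego n) A) = homs sug_arity A (Z_odd n)"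
  using homs_Z_odd_subset[of A n] by (auto simp: topo_dual_space)

lemma pop_dual_space:
  assumes "set us \<subseteq> homs sug_arity A (Z_odd n)"
  shows "pop (dual_space sug_arity (Z_odd n) (Z_ego n) A) s us =
    (if \<forall>a\<in>universe A. ego_interp s (map (\<lambda>u. u a) us) \<noteq> None
     then Some (\<lambda>a\<in>universe A. the (ego_interp s (map (\<lambda>u. u a) us))) else None)"
proof -
  have "pop (Z_ego n) s (map (\<lambda>u. u a) us) = ego_interp s (map (\<lambda>u. u a) us)" if "a \<in> universe A" for a
  proof -
    have "set (map (\<lambda>u. u a) us) \<subseteq> {- int n..int n}"
      using assms homs_Z_odd_subset[of A n] that by (fastforce simp: PiE_iff)
    then show ?thesis by (simp add: pop_Z_ego)
  qed
  moreover have "set us \<subseteq> universe A \<rightarrow>\<^sub>E {- int n..int n}" using assms homs_Z_odd_subset by blast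
  ultimately show ?thesis
    using assms by (auto simp: dual_space_def substr_def power_struct_def cong: restrict_cong)
qed

lemma pop_dual_space_args:
  "pop (dual_space sug_arity (Z_odd n) (Z_ego n) A) s us = Some v \<Longrightarrow> set us \<subseteq> homs sug_arity A (Z_odd n)"
  by (auto simp: dual_space_def substr_def split: if_splits)

text \<open>The same commutation seen from the other side: applying a symbol pointwise to
  homomorphisms gives a homomorphism.\<close>

lemma is_tstruct_dual_space:
  assumes A: "is_algebra sug_arity A"
  shows "is_tstruct (ego_sig n) (dual_space sug_arity (Z_odd n) (Z_ego n) A)"
  unfolding is_tstruct_def
proof (intro allI impI, elim conjE)
  fix s k us v assume s: "ego_sig n s = Some k"
    and v: "pop (dual_space sug_arity (Z_odd n) (Z_ego n) A) s us = Some v"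
  have us: "set us \<subseteq> homs sug_arity A (Z_odd n)" using pop_dual_space_args[OF v] .
  have def: "\<And>a. a \<in> universe A \<Longrightarrow> ego_interp s (map (\<lambda>u. u a) us) = Some (v a)"
    and v': "v = (\<lambda>a\<in>universe A. the (ego_interp s (map (\<lambda>u. u a) us)))"
    using v unfolding pop_dual_space[OF us] by (auto split: if_splits)
  have sd: "s \<in> dom (ego_sig n)" using s by auto
  obtain a0 where a0: "a0 \<in> universe A" using A by (auto simp: is_algebra_def)
  have "length us = k"
    using ego_interp_Some[OF def[OF a0]] s by (cases s) (auto split: if_splits)
  moreover have "v \<in> homs sug_arity A (Z_odd n)"
    unfolding homs_def
  proof (intro CollectI conjI allI impI)
    have "v a \<in> {- int n..int n}" if "a \<in> universe A" for a
    proof (rule ego_interp_range[OF def[OF that] _ sd])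
      show "set (map (\<lambda>u. u a) us) \<subseteq> {- int n..int n}"
        using us homs_Z_odd_subset[of A n] that by (fastforce simp: PiE_iff)
    qed
    then show "v \<in> universe A \<rightarrow>\<^sub>E universe (Z_odd n)" using v' by auto
    fix r as assume as: "length as = sug_arity r \<and> set as \<subseteq> universe A"
    then have ra: "op A r as \<in> universe A" using A by (simp add: is_algebra_def)
    show "v (op A r as) = op (Z_odd n) r (map v as)"
    proof (cases "s = Zero")
      case True
      then have 0: "v a = 0" if "a \<in> universe A" for a
        using def[OF that] ego_interp_Some[OF def[OF that]] by auto
      have "set (map v as) \<subseteq> {0}" using 0 as by auto
      then show ?thesis using 0[OF ra] as by (simp add: sug_interp_zero)
    next
      case False
      then obtain u where u: "us = [u]" using ego_interp_Some[OF def[OF a0]] by auto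
      have ur: "u (op A r as) = sug_interp r (map u as)" using us u as by (auto simp: homs_def)
      define k where "k w = the (ego_interp s [w])" for w
      have k: "ego_interp s [u a] = Some (k (u a))" "k (u a) = v a" if "a \<in> universe A" for a
        using def[OF that] u by (auto simp: k_def)
      have m: "map v as = map k (map u as)" using k(2) as by auto
      have "ego_interp s [u (op A r as)] = Some (sug_interp r (map v as))"
        unfolding m ur using as k(1) False by (intro ego_interp_sug_interp) auto
      then show ?thesis using def[OF ra] u by simp
    qed
  qed
  ultimately show "length us = k \<and> set us \<subseteq> points (dual_space sug_arity (Z_odd n) (Z_ego n) A) \<and>
      v \<in> points (dual_space sug_arity (Z_odd n) (Z_ego n) A)"
    using us by simp
qed

lemma compact_space_power_discrete:
  "compact_space (product_topology (\<lambda>_. discrete_topology {- int n..int n}) I)"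
  by (simp add: compact_space_product_topology compact_space_discrete_topology)

text \<open>Each failure of the homomorphism condition involves finitely many coordinates, so the
  homomorphisms form a closed subset of a compact power.\<close>

lemma compact_space_dual_space:
  assumes A: "is_algebra sug_arity A"
  shows "compact_space (topo (dual_space sug_arity (Z_odd n) (Z_ego n) A))"
proof -
  let ?P = "product_topology (\<lambda>_. discrete_topology {- int n..int n}) (universe A)"
  let ?K = "{(s, as). length as = sug_arity s \<and> set as \<subseteq> universe A}"
  have "openin ?P {u \<in> topspace ?P. u (op A s as) \<noteq> sug_interp s (map u as)}"
    if K: "length as = sug_arity s" "set as \<subseteq> universe A" for s as
  proof -
    have proj: "continuous_map ?P (discrete_topology {- int n..int n}) (\<lambda>u. u a)" if "a \<in> universe A" for a
      using continuous_map_product_projection[OF that] .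
    have "continuous_map ?P (discrete_topology {- int n..int n})
        (\<lambda>u. sug_interp s (map (\<lambda>f. f u) (map (\<lambda>a u. u a) as)))"
      using K proj by (intro continuous_map_sug_interp) auto
    moreover have "op A s as \<in> universe A" using A K by (auto simp: is_algebra_def)
    ultimately show ?thesis
      using openin_discrete_pair[OF proj, of "op A s as" _ _ "(\<noteq>)"] by (simp add: comp_def)
  qed
  moreover have "topspace ?P - homs sug_arity A (Z_odd n) =
      (\<Union>(s, as)\<in>?K. {u \<in> topspace ?P. u (op A s as) \<noteq> sug_interp s (map u as)})"
    by (auto simp: homs_def)
  ultimately have "openin ?P (topspace ?P - homs sug_arity A (Z_odd n))" by (auto intro!: openin_Union)
  then have "closedin ?P (homs sug_arity A (Z_odd n))"
    using homs_Z_odd_subset by (simp add: closedin_def)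
  then show ?thesis
    unfolding topo_dual_space
    by (intro compact_space_subtopology closedin_compact_space compact_space_power_discrete)
qed

lemma dual_subspace_dual_space:
  assumes A: "is_algebra sug_arity A"
  shows "dual_subspace n (dual_space sug_arity (Z_odd n) (Z_ego n) A) A (\<lambda>u. u)"
proof
  let ?X = "dual_space sug_arity (Z_odd n) (Z_ego n) A"
  show "is_tstruct (ego_sig n) ?X" by (rule is_tstruct_dual_space[OF A])
  show "compact_space (topo ?X)" by (rule compact_space_dual_space[OF A])
  \<comment> \<open>The constant homomorphism 0 exists for every algebra and keeps the dual space
    nonempty.\<close>
  have "(\<lambda>a\<in>universe A. 0) \<in> homs sug_arity A (Z_odd n)"
    unfolding homs_def
  proof (intro CollectI conjI allI impI)
    fix r as assume as: "length as = sug_arity r \<and> set as \<subseteq> universe A"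
    then have "op A r as \<in> universe A" using A by (simp add: is_algebra_def)
    moreover have "set (map (\<lambda>a\<in>universe A. 0 :: int) as) \<subseteq> {0}" using as by auto
    then have "sug_interp r (map (\<lambda>a\<in>universe A. 0) as) = 0" using as by (intro sug_interp_zero) auto
    ultimately show "(\<lambda>a\<in>universe A. 0) (op A r as) = op (Z_odd n) r (map (\<lambda>a\<in>universe A. 0) as)" by simp
  qed auto
  then show "points ?X \<noteq> {}" by auto
  show "continuous_map (topo ?X) (discrete_topology {- int n..int n}) (\<lambda>u. u a)" if "a \<in> universe A" for a
    using continuous_map_product_projection[OF that, of "\<lambda>_. discrete_topology {- int n..int n}"]
    by (simp add: topo_dual_space continuous_map_from_subtopology)
  show "ego_interp s [u a] = Some (v a)"
    if "s \<in> dom (ego_sig n)" "a \<in> universe A" "pop ?X s [u] = Some v" for s u v a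
    using that pop_dual_space[OF pop_dual_space_args[OF that(3)], of s] by (auto split: if_splits)
  show "pop ?X s [u] \<noteq> None"
    if "s \<in> dom (ego_sig n)" "u \<in> points ?X" "\<And>a. a \<in> universe A \<Longrightarrow> ego_interp s [u a] \<noteq> None" for s u
    using that pop_dual_space[of "[u]" A n s] by simp
qed (use A in auto)

section \<open>Structures in the dual category and fullness\<close>

text \<open>The coordinates of an isomorphism onto a closed substructure of a power are morphisms to
  the alter ego. They separate points and detect where a symbol is defined; compactness comes from
  the power.\<close>

lemma IScP_properties:
  assumes "X \<in> IScP (ego_sig n) (Z_ego n) TYPE('i)"
  shows "is_tstruct (ego_sig n) X" "compact_space (topo X)" "points X \<noteq> {}"
    "morphs (ego_sig n) X (Z_ego n) \<noteq> {}"
    and "\<And>x y. x \<in> points X \<Longrightarrow> y \<in> points X \<Longrightarrow>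
      (\<And>\<alpha>. \<alpha> \<in> morphs (ego_sig n) X (Z_ego n) \<Longrightarrow> \<alpha> x = \<alpha> y) \<Longrightarrow> x = y"
    and "\<And>s xs. s \<in> dom (ego_sig n) \<Longrightarrow> set xs \<subseteq> points X \<Longrightarrow>
      (\<And>\<alpha>. \<alpha> \<in> morphs (ego_sig n) X (Z_ego n) \<Longrightarrow> ego_interp s (map \<alpha> xs) \<noteq> None) \<Longrightarrow> pop X s xs \<noteq> None"
proof -
  let ?M = "{- int n..int n}" and ?mor = "morphs (ego_sig n) X (Z_ego n)"
  obtain I :: "'i set" and S \<phi> where I: "I \<noteq> {}" and S: "closed_substr (ego_sig n) S (power_struct (Z_ego n) I)"
    and \<phi>: "struct_iso (ego_sig n) X (substr (power_struct (Z_ego n) I) S) \<phi>"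
    using assms by (auto simp: IScP_def)
  show ts: "is_tstruct (ego_sig n) X" using assms by (simp add: IScP_def)
  let ?P = "product_topology (\<lambda>_. discrete_topology ?M) I"
  let ?Q = "substr (power_struct (Z_ego n) I) S"
  have cl: "closedin ?P S" using S by (simp add: closed_substr_def power_struct_def)
  have topQ: "topo ?Q = subtopology ?P S" by (simp add: substr_def power_struct_def)
  have SP: "S \<subseteq> I \<rightarrow>\<^sub>E ?M" using closedin_subset[OF cl] by simp
  then have pQ: "points ?Q = S" by (auto simp: topQ)
  have popQ: "pop ?Q s xs = (if \<forall>i\<in>I. ego_interp s (map (\<lambda>x. x i) xs) \<noteq> None
      then Some (\<lambda>i\<in>I. the (ego_interp s (map (\<lambda>x. x i) xs))) else None)" if "set xs \<subseteq> S" for s xs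
  proof -
    have "pop (Z_ego n) s (map (\<lambda>x. x i) xs) = ego_interp s (map (\<lambda>x. x i) xs)" if "i \<in> I" for i
    proof -
      have "set (map (\<lambda>x. x i) xs) \<subseteq> ?M" using \<open>set xs \<subseteq> S\<close> SP that by (fastforce simp: PiE_iff)
      then show ?thesis by (simp add: pop_Z_ego)
    qed
    moreover have "set xs \<subseteq> I \<rightarrow>\<^sub>E ?M" using that SP by blast
    ultimately show ?thesis
      using that by (auto simp: substr_def power_struct_def cong: restrict_cong)
  qed
  have hm: "homeomorphic_map (topo X) (subtopology ?P S) \<phi>"
    and refl: "\<And>s xs. s \<in> dom (ego_sig n) \<Longrightarrow> set xs \<subseteq> points X \<Longrightarrow> pop ?Q s (map \<phi> xs) \<noteq> None \<Longrightarrow> pop X s xs \<noteq> None"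
    and \<phi>m: "\<phi> \<in> morphs (ego_sig n) X ?Q"
    using \<phi> by (auto simp: struct_iso_def topQ)
  have \<phi>S: "\<phi> x \<in> S" if "x \<in> points X" for x using \<phi>m that pQ by (auto simp: morphs_def)
  have "compact_space (subtopology ?P S)"
    by (intro compact_space_subtopology closedin_compact_space compact_space_power_discrete cl)
  then show "compact_space (topo X)"
    using hm homeomorphic_compact_space homeomorphic_map_imp_homeomorphic_space by blast
  \<comment> \<open>The constant is defined in every power, and the isomorphism reflects its domain,
    so \<open>X\<close> has a point.\<close>
  have "pop ?Q Zero (map \<phi> []) \<noteq> None" using popQ[of "[]" Zero] by simp
  then obtain z where "pop X Zero [] = Some z" using refl[of Zero "[]"] by (auto simp: ego_sig_dom)
  then have "z \<in> points X" using ts[unfolded is_tstruct_def, rule_format, of Zero 0 "[]" z] by simp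
  then show "points X \<noteq> {}" by blast
  have coord: "(\<lambda>x\<in>points X. \<phi> x i) \<in> ?mor" if i: "i \<in> I" for i
  proof (rule morphs_Z_egoI)
    show "(\<lambda>x\<in>points X. \<phi> x i) \<in> points X \<rightarrow>\<^sub>E ?M"
      using \<phi>S SP i by (fastforce simp: PiE_iff)
    have "continuous_map (subtopology ?P S) (discrete_topology ?M) (\<lambda>u. u i)"
      using continuous_map_product_projection[OF i, of "\<lambda>_. discrete_topology ?M"]
      by (simp add: continuous_map_from_subtopology)
    from continuous_map_compose[OF homeomorphic_imp_continuous_map[OF hm] this]
    show "continuous_map (topo X) (discrete_topology ?M) (\<lambda>x\<in>points X. \<phi> x i)"
      by (rule continuous_map_eq) simp
    fix s xs y assume s: "s \<in> dom (ego_sig n)" and xs: "set xs \<subseteq> points X" and y: "pop X s xs = Some y"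
    have "pop ?Q s (map \<phi> xs) = Some (\<phi> y)" using \<phi>m s xs y by (auto simp: morphs_def)
    moreover have "set (map \<phi> xs) \<subseteq> S" using xs \<phi>S by auto
    ultimately have d: "\<forall>i\<in>I. ego_interp s (map (\<lambda>x. x i) (map \<phi> xs)) \<noteq> None"
      "\<phi> y = (\<lambda>i\<in>I. the (ego_interp s (map (\<lambda>x. x i) (map \<phi> xs))))"
      using popQ[of "map \<phi> xs" s] by (auto simp del: map_map split: if_splits)
    then have "ego_interp s (map (\<lambda>x. x i) (map \<phi> xs)) = Some (\<phi> y i)"
      using d(1) i unfolding d(2) by auto
    moreover have "map (\<lambda>x\<in>points X. \<phi> x i) xs = map (\<lambda>x. x i) (map \<phi> xs)" using xs by auto
    moreover have "y \<in> points X" using ts s y unfolding is_tstruct_def by blast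
    ultimately show "ego_interp s (map (\<lambda>x\<in>points X. \<phi> x i) xs) = Some ((\<lambda>x\<in>points X. \<phi> x i) y)" by (simp del: map_eq_conv map_map)
  qed
  then show "?mor \<noteq> {}" using I by blast
  show "x = y" if "x \<in> points X" "y \<in> points X" "\<And>\<alpha>. \<alpha> \<in> ?mor \<Longrightarrow> \<alpha> x = \<alpha> y" for x y
  proof -
    have "\<phi> x i = \<phi> y i" if "i \<in> I" for i
      using \<open>\<And>\<alpha>. \<alpha> \<in> ?mor \<Longrightarrow> \<alpha> x = \<alpha> y\<close>[OF coord[OF that]] \<open>x \<in> points X\<close> \<open>y \<in> points X\<close> by simp
    moreover have "\<phi> x \<in> I \<rightarrow>\<^sub>E ?M" "\<phi> y \<in> I \<rightarrow>\<^sub>E ?M" using \<phi>S SP that by blast+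
    ultimately have "\<phi> x = \<phi> y" by (intro PiE_ext) auto
    then show ?thesis using homeomorphic_imp_injective_map[OF hm] that by (auto dest: inj_onD)
  qed
  show "pop X s xs \<noteq> None"
    if s: "s \<in> dom (ego_sig n)" and xs: "set xs \<subseteq> points X"
      and def: "\<And>\<alpha>. \<alpha> \<in> ?mor \<Longrightarrow> ego_interp s (map \<alpha> xs) \<noteq> None" for s xs
  proof (rule refl[OF s xs])
    have "ego_interp s (map (\<lambda>x. x i) (map \<phi> xs)) \<noteq> None" if "i \<in> I" for i
    proof -
      have "map (\<lambda>x\<in>points X. \<phi> x i) xs = map (\<lambda>x. x i) (map \<phi> xs)" using xs by auto
      then show ?thesis using def[OF coord[OF that]] by (simp del: map_eq_conv map_map)
    qed
    moreover have "set (map \<phi> xs) \<subseteq> S" using xs \<phi>S by auto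
    ultimately show "pop ?Q s (map \<phi> xs) \<noteq> None" using popQ by simp
  qed
qed


context
  fixes n :: nat and X :: "(ego_sym, 'x) tstruct"
  assumes X: "X \<in> IScP (ego_sig n) (Z_ego n) TYPE('i)"
begin

lemma eval_space_homs:
  assumes "x \<in> points X"
  shows "eval_space (ego_sig n) (Z_ego n) X x \<in>
    homs sug_arity (dual_alg (ego_sig n) (Z_odd n) (Z_ego n) X) (Z_odd n)"
  unfolding homs_def
proof (intro CollectI conjI allI impI)
  let ?ev = "eval_space (ego_sig n) (Z_ego n) X x" and ?E = "dual_alg (ego_sig n) (Z_odd n) (Z_ego n) X"
  show "?ev \<in> universe ?E \<rightarrow>\<^sub>E universe (Z_odd n)"
    using assms morphs_Z_egoD(1) by (fastforce simp: eval_space_def)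
  fix s fs assume fs: "length fs = sug_arity s \<and> set fs \<subseteq> universe ?E"
  have "op ?E s fs \<in> universe ?E"
    using is_algebra_dual_alg[OF IScP_properties(1,4)[OF X]] fs by (simp add: is_algebra_def)
  then have "?ev (op ?E s fs) = sug_interp s (map (\<lambda>f. f x) fs)"
    using assms by (simp add: eval_space_def)
  moreover have "map ?ev fs = map (\<lambda>f. f x) fs"
    using fs assms by (auto simp: eval_space_def)
  ultimately show "?ev (op ?E s fs) = op (Z_odd n) s (map ?ev fs)" by (simp del: map_eq_conv)
qed

text \<open>There are enough morphisms on \<open>X\<close> to separate points and detect domains, so
  evaluation places \<open>X\<close> inside the dual space of its dual algebra.\<close>

lemma dual_subspace_eval_space:
  "dual_subspace n X (dual_alg (ego_sig n) (Z_odd n) (Z_ego n) X) (eval_space (ego_sig n) (Z_ego n) X)"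
proof
  let ?ev = "eval_space (ego_sig n) (Z_ego n) X" and ?E = "dual_alg (ego_sig n) (Z_odd n) (Z_ego n) X"
  note props = IScP_properties[OF X]
  have ev: "?ev x f = f x" if "x \<in> points X" "f \<in> universe ?E" for x f
    using that by (simp add: eval_space_def)
  show "is_tstruct (ego_sig n) X" "compact_space (topo X)" "points X \<noteq> {}" by (fact props)+
  show "is_algebra sug_arity ?E" by (rule is_algebra_dual_alg) (fact props)+
  show "?ev x \<in> homs sug_arity ?E (Z_odd n)" if "x \<in> points X" for x
    using eval_space_homs[OF that] .
  show "continuous_map (topo X) (discrete_topology {- int n..int n}) (\<lambda>x. ?ev x f)" if "f \<in> universe ?E" for f
    by (rule continuous_map_eq[OF morphs_Z_egoD(2)]) (use that ev in auto)
  show "ego_interp s [?ev x f] = Some (?ev y f)"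
    if s: "s \<in> dom (ego_sig n)" "f \<in> universe ?E" "pop X s [x] = Some y" for s f x y
  proof -
    have xy: "set [x] \<subseteq> points X" "y \<in> points X"
      using props(1) s unfolding is_tstruct_def by blast+
    then show ?thesis using morphs_Z_egoD(3)[OF _ s(1) xy(1) s(3)] s(2) ev by simp
  qed
  show "pop X s [x] \<noteq> None"
    if s: "s \<in> dom (ego_sig n)" "x \<in> points X" "\<And>f. f \<in> universe ?E \<Longrightarrow> ego_interp s [?ev x f] \<noteq> None" for s x
  proof (rule props(6)[OF s(1)])
    show "ego_interp s (map f [x]) \<noteq> None" if "f \<in> morphs (ego_sig n) X (Z_ego n)" for f
      using s(3)[of f] s(2) that ev by simp
  qed (use s(2) in simp)
  show "inj_on ?ev (points X)"
  proof (rule inj_onI)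
    fix x y assume xy: "x \<in> points X" "y \<in> points X" "?ev x = ?ev y"
    show "x = y" by (rule props(5)[OF xy(1,2)]) (use ev xy in \<open>metis universe_dual_alg\<close>)
  qed
qed

text \<open>Surjectivity is \<open>hom_is_point\<close>, since different morphisms differ at some
  point. A continuous bijection from a compact space to a Hausdorff space is a
  homeomorphism.\<close>

lemma struct_iso_eval_space:
  "struct_iso (ego_sig n) X
     (dual_space sug_arity (Z_odd n) (Z_ego n) (dual_alg (ego_sig n) (Z_odd n) (Z_ego n) X))
     (eval_space (ego_sig n) (Z_ego n) X)"
proof -
  let ?ev = "eval_space (ego_sig n) (Z_ego n) X" and ?E = "dual_alg (ego_sig n) (Z_odd n) (Z_ego n) X"
  let ?D = "dual_space sug_arity (Z_odd n) (Z_ego n) ?E" and ?mor = "morphs (ego_sig n) X (Z_ego n)"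
  interpret dual_subspace n X ?E ?ev by (rule dual_subspace_eval_space)
  have ev: "?ev x f = f x" if "x \<in> points X" "f \<in> ?mor" for x f
    using that by (simp add: eval_space_def)
  have mapev: "map (\<lambda>u. u f) (map ?ev xs) = map f xs" if "set xs \<subseteq> points X" "f \<in> ?mor" for xs f
    using that ev by auto
  have evxs: "set (map ?ev xs) \<subseteq> homs sug_arity ?E (Z_odd n)" if "set xs \<subseteq> points X" for xs
    using that hom by auto
  have ext: "?ev \<in> points X \<rightarrow>\<^sub>E points ?D" using hom by (auto simp: eval_space_def)
  have cm: "continuous_map (topo X) (topo ?D) ?ev"
    unfolding topo_dual_space continuous_map_in_subtopology continuous_map_componentwise
    using hom cont homs_Z_odd_subset[of ?E n] by (auto simp: PiE_iff eval_space_def)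
  have pop: "pop ?D s (map ?ev xs) = Some (?ev y)"
    if s: "s \<in> dom (ego_sig n)" "set xs \<subseteq> points X" "pop X s xs = Some y" for s xs y
  proof -
    have "ego_interp s (map (\<lambda>u. u f) (map ?ev xs)) = Some (f y)" if "f \<in> ?mor" for f
      using morphs_Z_egoD(3)[OF that s] mapev[OF s(2) that] by (simp del: map_eq_conv map_map)
    moreover have "?ev y = (\<lambda>f\<in>?mor. f y)" using pop_points(2)[OF s(1,3)] by (simp add: eval_space_def)
    ultimately show ?thesis
      unfolding pop_dual_space[OF evxs[OF s(2)]] by (auto intro!: restrict_ext)
  qed
  have onto: "?ev ` points X = points ?D"
  proof
    show "?ev ` points X \<subseteq> points ?D" using hom by auto
    show "points ?D \<subseteq> ?ev ` points X"
    proof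
      fix u assume "u \<in> points ?D"
      then have "u \<in> homs sug_arity ?E (Z_odd n)" by (simp only: points_dual_space)
      moreover have "f = g" if "f \<in> universe ?E" "g \<in> universe ?E" "\<And>x. x \<in> points X \<Longrightarrow> ?ev x f = ?ev x g" for f g
      proof (rule PiE_ext)
        show "f \<in> points X \<rightarrow>\<^sub>E {- int n..int n}" "g \<in> points X \<rightarrow>\<^sub>E {- int n..int n}"
          using that(1,2) morphs_Z_egoD(1) by auto
        show "f x = g x" if "x \<in> points X" for x
          using \<open>\<And>x. x \<in> points X \<Longrightarrow> ?ev x f = ?ev x g\<close>[OF that] ev that \<open>f \<in> universe ?E\<close> \<open>g \<in> universe ?E\<close> by simp
      qed
      ultimately show "u \<in> ?ev ` points X" using hom_is_point by blast
    qed
  qed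
  have "Hausdorff_space (topo ?D)"
    unfolding topo_dual_space
    by (intro Hausdorff_space_subtopology) (simp add: Hausdorff_space_product_topology Hausdorff_space_discrete_topology)
  then have "homeomorphic_map (topo X) (topo ?D) ?ev"
    using continuous_imp_homeomorphic_map compact cm onto inj by blast
  moreover have "pop X s xs \<noteq> None"
    if s: "s \<in> dom (ego_sig n)" "set xs \<subseteq> points X" "pop ?D s (map ?ev xs) \<noteq> None" for s xs
  proof (rule IScP_properties(6)[OF X s(1,2)])
    show "ego_interp s (map f xs) \<noteq> None" if "f \<in> ?mor" for f
      using s(3) mapev[OF s(2) that] that unfolding pop_dual_space[OF evxs[OF s(2)]]
      by (metis universe_dual_alg)
  qed
  ultimately show ?thesis
    unfolding struct_iso_def morphs_def using ext cm pop by simp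
qed

end

section \<open>Restriction to substructures, duality and injectivity\<close>

text \<open>For injectivity: the algebra stays that of the larger structure while the points shrink.
  Domains are still detected because an embedding reflects them.\<close>

lemma dual_subspace_restrict:
  assumes "dual_subspace n Y A e" and emb: "struct_embedding (ego_sig n) X Y \<phi>"
    and ts: "is_tstruct (ego_sig n) X" and X: "compact_space (topo X)" "points X \<noteq> {}"
  shows "dual_subspace n X A (\<lambda>x. e (\<phi> x))"
proof -
  interpret Y: dual_subspace n Y A e by fact
  let ?S = "\<phi> ` points X"
  let ?Q = "substr Y ?S"
  have iso: "\<phi> \<in> morphs (ego_sig n) X ?Q" "homeomorphic_map (topo X) (topo ?Q) \<phi>"
    and refl: "\<And>s xs. s \<in> dom (ego_sig n) \<Longrightarrow> set xs \<subseteq> points X \<Longrightarrow> pop ?Q s (map \<phi> xs) \<noteq> None \<Longrightarrow> pop X s xs \<noteq> None"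
    using emb by (auto simp: struct_embedding_def struct_iso_def)
  have sub: "?S \<subseteq> points Y"
    using emb by (auto simp: struct_embedding_def closed_substr_def dest: closedin_subset)
  have \<phi>Y: "\<phi> x \<in> points Y" if "x \<in> points X" for x using sub that by blast
  have c\<phi>: "continuous_map (topo X) (topo Y) \<phi>"
    using homeomorphic_imp_continuous_map[OF iso(2)] by (simp add: substr_def continuous_map_in_subtopology)
  show ?thesis
  proof
    show "is_tstruct (ego_sig n) X" "compact_space (topo X)" "points X \<noteq> {}" by fact+
    show "is_algebra sug_arity A" by (fact Y.alg)
    show "e (\<phi> x) \<in> homs sug_arity A (Z_odd n)" if "x \<in> points X" for x
      using Y.hom \<phi>Y that by blast
    show "continuous_map (topo X) (discrete_topology {- int n..int n}) (\<lambda>x. e (\<phi> x) a)" if "a \<in> universe A" for a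
      using continuous_map_compose[OF c\<phi> Y.cont[OF that]] by (simp add: comp_def)
    show "ego_interp s [e (\<phi> x) a] = Some (e (\<phi> y) a)"
      if s: "s \<in> dom (ego_sig n)" "a \<in> universe A" "pop X s [x] = Some y" for s a x y
    proof -
      have "set [x] \<subseteq> points X" using ts s unfolding is_tstruct_def by blast
      then have "pop ?Q s (map \<phi> [x]) = Some (\<phi> y)"
        using iso(1) s(1,3) unfolding morphs_def by blast
      then have "pop Y s [\<phi> x] = Some (\<phi> y)" by (simp add: substr_def split: if_splits)
      then show ?thesis by (rule Y.pres[OF s(1,2)])
    qed
    show "pop X s [x] \<noteq> None"
      if s: "s \<in> dom (ego_sig n)" "x \<in> points X" "\<And>a. a \<in> universe A \<Longrightarrow> ego_interp s [e (\<phi> x) a] \<noteq> None" for s x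
    proof (rule refl[OF s(1)])
      have "pop Y s [\<phi> x] \<noteq> None" using Y.reflect[OF s(1) \<phi>Y[OF s(2)] s(3)] .
      then show "pop ?Q s (map \<phi> [x]) \<noteq> None" using s(2) by (simp add: substr_def)
    qed (use s in simp)
    have "inj_on \<phi> (points X)" using homeomorphic_imp_injective_map[OF iso(2)] .
    then show "inj_on (\<lambda>x. e (\<phi> x)) (points X)"
      using comp_inj_on[OF _ inj_on_subset[OF Y.inj sub]] by (simp add: comp_def)
  qed
qed

text \<open>The coordinates of an embedding into a power are homomorphisms, and they determine an
  element.\<close>

lemma ISP_separated:
  assumes A: "A \<in> ISP sug_arity (Z_odd n) TYPE('i)" and ab: "a \<in> universe A" "b \<in> universe A"
    and eq: "\<And>u. u \<in> homs sug_arity A (Z_odd n) \<Longrightarrow> u a = u b"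
  shows "a = b"
proof -
  obtain I :: "'i set" and S h where S: "is_subuniverse sug_arity S (power_alg (Z_odd n) I)"
    and h: "alg_iso sug_arity A (subalg (power_alg (Z_odd n) I) S) h" and alg: "is_algebra sug_arity A"
    using A by (auto simp: ISP_def)
  have SP: "S \<subseteq> I \<rightarrow>\<^sub>E {- int n..int n}" using S by (simp add: is_subuniverse_def)
  have hS: "h c \<in> S" if "c \<in> universe A" for c
    using h that by (auto simp: alg_iso_def homs_def)
  have h_op: "h (op A s as) i = sug_interp s (map (\<lambda>c. h c i) as)"
    if "length as = sug_arity s" "set as \<subseteq> universe A" "i \<in> I" for s as i
    using h that by (simp add: alg_iso_def homs_def comp_def)
  have "h a i = h b i" if i: "i \<in> I" for i
  proof -
    let ?u = "\<lambda>c\<in>universe A. h c i"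
    have "?u \<in> homs sug_arity A (Z_odd n)"
      unfolding homs_def
    proof (intro CollectI conjI allI impI)
      show "?u \<in> universe A \<rightarrow>\<^sub>E universe (Z_odd n)" using hS SP i by (fastforce simp: PiE_iff)
      fix s as assume as: "length as = sug_arity s \<and> set as \<subseteq> universe A"
      then have "op A s as \<in> universe A" using alg by (simp add: is_algebra_def)
      moreover have "map ?u as = map (\<lambda>c. h c i) as" using as by auto
      ultimately show "?u (op A s as) = op (Z_odd n) s (map ?u as)" using h_op as i by (simp del: map_eq_conv)
    qed
    from eq[OF this] show ?thesis using ab by simp
  qed
  moreover have "h a \<in> I \<rightarrow>\<^sub>E {- int n..int n}" "h b \<in> I \<rightarrow>\<^sub>E {- int n..int n}" using hS SP ab by blast+
  ultimately have "h a = h b" by (intro PiE_ext) auto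
  then show ?thesis using h ab by (auto simp: alg_iso_def bij_betw_def dest: inj_onD)
qed

text \<open>Evaluation is injective by \<open>ISP_separated\<close> and onto by
  \<open>morph_is_evaluation\<close>, applied to the whole dual space.\<close>

lemma alg_iso_eval_alg:
  assumes A: "A \<in> ISP sug_arity (Z_odd n) TYPE('i)"
  shows "alg_iso sug_arity A
    (dual_alg (ego_sig n) (Z_odd n) (Z_ego n) (dual_space sug_arity (Z_odd n) (Z_ego n) A))
    (eval_alg sug_arity (Z_odd n) A)"
proof -
  let ?D = "dual_space sug_arity (Z_odd n) (Z_ego n) A" and ?ev = "eval_alg sug_arity (Z_odd n) A"
  let ?hom = "homs sug_arity A (Z_odd n)"
  let ?E = "dual_alg (ego_sig n) (Z_odd n) (Z_ego n) ?D"
  have alg: "is_algebra sug_arity A" using A by (simp add: ISP_def)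
  interpret dual_subspace n ?D A "\<lambda>u. u" by (rule dual_subspace_dual_space[OF alg])
  have ev: "?ev a = (\<lambda>u\<in>?hom. u a)" if "a \<in> universe A" for a
    using that by (simp add: eval_alg_def)
  have mor: "?ev a \<in> morphs (ego_sig n) ?D (Z_ego n)" if a: "a \<in> universe A" for a
  proof (rule morphs_Z_egoI)
    show "?ev a \<in> points ?D \<rightarrow>\<^sub>E {- int n..int n}"
      unfolding ev[OF a] points_dual_space using hom_bound[OF _ a] by auto
    show "continuous_map (topo ?D) (discrete_topology {- int n..int n}) (?ev a)"
      by (rule continuous_map_eq[OF cont[OF a]]) (simp only: ev[OF a] points_dual_space restrict_apply' )
    fix s us v assume s: "s \<in> dom (ego_sig n)" and us: "set us \<subseteq> points ?D" and v: "pop ?D s us = Some v"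
    have us': "set us \<subseteq> ?hom" using us by (simp only: points_dual_space)
    have "ego_interp s (map (\<lambda>u. u a) us) = Some (v a)"
      using v a unfolding pop_dual_space[OF us'] by (auto split: if_splits)
    moreover have "map (?ev a) us = map (\<lambda>u. u a) us" using us' ev[OF a] by auto
    moreover have "v \<in> ?hom" using pop_points(2)[OF s v] by (simp only: points_dual_space)
    ultimately show "ego_interp s (map (?ev a) us) = Some (?ev a v)" using ev[OF a] by (simp del: map_eq_conv)
  qed
  have "?ev \<in> homs sug_arity A ?E"
    unfolding homs_def
  proof (intro CollectI conjI allI impI)
    show "?ev \<in> universe A \<rightarrow>\<^sub>E universe ?E" using mor by (auto simp: eval_alg_def)
    fix s as assume as: "length as = sug_arity s \<and> set as \<subseteq> universe A"
    then have "op A s as \<in> universe A" using alg by (simp add: is_algebra_def)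
    then have "?ev (op A s as) = (\<lambda>u\<in>?hom. u (op A s as))" by (rule ev)
    also have "\<dots> = (\<lambda>u\<in>?hom. sug_interp s (map (\<lambda>f. f u) (map ?ev as)))"
    proof (rule restrict_ext)
      fix u assume u: "u \<in> ?hom"
      have "map (\<lambda>f. f u) (map ?ev as) = map u as" using as u ev by auto
      then show "u (op A s as) = sug_interp s (map (\<lambda>f. f u) (map ?ev as))"
        using u as by (simp add: homs_def del: map_eq_conv map_map)
    qed
    finally show "?ev (op A s as) = op ?E s (map ?ev as)"
      unfolding op_dual_alg points_dual_space by simp
  qed
  moreover have "inj_on ?ev (universe A)"
  proof (rule inj_onI)
    fix a b assume ab: "a \<in> universe A" "b \<in> universe A" "?ev a = ?ev b"
    show "a = b"
    proof (rule ISP_separated[OF A ab(1,2)])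
      show "u a = u b" if "u \<in> ?hom" for u
        using fun_cong[OF ab(3), of u] that ev ab(1,2) by simp
    qed
  qed
  moreover have "?ev ` universe A = universe ?E"
  proof
    show "?ev ` universe A \<subseteq> universe ?E" using mor by auto
    show "universe ?E \<subseteq> ?ev ` universe A"
    proof
      fix \<alpha> assume "\<alpha> \<in> universe ?E"
      then have \<alpha>: "\<alpha> \<in> morphs (ego_sig n) ?D (Z_ego n)" by simp
      obtain a where a: "a \<in> universe A" "\<And>u. u \<in> ?hom \<Longrightarrow> u a = \<alpha> u"
        using morph_is_evaluation[OF \<alpha>] unfolding points_dual_space by blast
      have "\<alpha> \<in> ?hom \<rightarrow>\<^sub>E {- int n..int n}" using morphs_Z_egoD(1)[OF \<alpha>] unfolding points_dual_space .
      then have "?ev a = \<alpha>" unfolding ev[OF a(1)] using a(2) by (auto simp: fun_eq_iff PiE_iff extensional_def)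
      then show "\<alpha> \<in> ?ev ` universe A" using a(1) by blast
    qed
  qed
  ultimately show ?thesis by (simp add: alg_iso_def bij_betw_def)
qed

text \<open>With the dual algebra of \<open>Y\<close> acting on \<open>X\<close>, a morphism
  \<open>\<alpha>\<close> on \<open>X\<close> is evaluation at an element of that algebra; this
  element is itself a morphism on \<open>Y\<close>, the required extension.\<close>

lemma injective_Z_ego: "injective_in_IScP (ego_sig n) (Z_ego n) TYPE('x) TYPE('i)"
  unfolding injective_in_IScP_def
proof (intro allI impI, elim conjE)
  fix X Y :: "(ego_sym, 'x) tstruct" and \<phi> \<alpha>
  assume X: "X \<in> IScP (ego_sig n) (Z_ego n) TYPE('i)" and Y: "Y \<in> IScP (ego_sig n) (Z_ego n) TYPE('i)"
    and emb: "struct_embedding (ego_sig n) X Y \<phi>" and \<alpha>: "\<alpha> \<in> morphs (ego_sig n) X (Z_ego n)"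
  let ?ev = "eval_space (ego_sig n) (Z_ego n) Y" and ?E = "dual_alg (ego_sig n) (Z_odd n) (Z_ego n) Y"
  interpret dual_subspace n X ?E "\<lambda>x. ?ev (\<phi> x)"
    using dual_subspace_restrict[OF dual_subspace_eval_space[OF Y] emb IScP_properties(1-3)[OF X]] .
  obtain \<beta> where \<beta>: "\<beta> \<in> morphs (ego_sig n) Y (Z_ego n)" "\<And>x. x \<in> points X \<Longrightarrow> ?ev (\<phi> x) \<beta> = \<alpha> x"
    using morph_is_evaluation[OF \<alpha>] by auto
  have "\<phi> x \<in> points Y" if "x \<in> points X" for x
    using emb that by (auto simp: struct_embedding_def closed_substr_def dest!: closedin_subset)
  then have "\<forall>x\<in>points X. \<beta> (\<phi> x) = \<alpha> x" using \<beta> by (simp add: eval_space_def)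
  then show "\<exists>\<beta>\<in>morphs (ego_sig n) Y (Z_ego n). \<forall>x\<in>points X. \<beta> (\<phi> x) = \<alpha> x" using \<beta>(1) by blast
qed

theorem theorem4p3:
  fixes n :: nat
  assumes "n \<ge> 1"
  shows "is_alter_ego sug_arity (ego_sig n) (Z_odd n) (Z_ego n) \<and>
    yields_strong_duality sug_arity (ego_sig n) (Z_odd n) (Z_ego n)
      TYPE('a) TYPE('x) TYPE('i)"
  using is_alter_ego_Z_ego[OF assms] alg_iso_eval_alg struct_iso_eval_space injective_Z_ego
  unfolding yields_strong_duality_def yields_full_duality_def yields_duality_def by blast

end
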